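(* Let $\mathfrak{g}$ be a finite dimensional complex quadratic Lie algebra with bilinear form $B$. As a graded associative algebra (for the induced $\wedge$-product), the cyclic cohomology $H_c^*(\mathfrak{g})$ is isomorphic to $H^*_+(\mathfrak{g})$; and as a graded Lie algebra, $H_c^*(\mathfrak{g})$ is isomorphic to $H_Q^*(\mathfrak{g})$.
   Context: A quadratic Lie algebra is a Lie algebra with a non degenerate symmetric invariant bilinear form $B$. $\bigwedge^p\mathfrak{g}$ is the space of skew symmetric $p$-linear forms on $\mathfrak{g}$, $\bigwedge\mathfrak{g}=\sum_{p\ge0}\bigwedge^p\mathfrak{g}$ with the wedge product, $\bigwedge_+\mathfrak{g}=\sum_{p\ge1}\bigwedge^p\mathfrak{g}$, $\iota_X\Omega=\Omega(X,\cdot,\dots)$, and $\partial$ is the Chevalley differential (trivial coefficients). $H^*(\mathfrak{g})$ is the cohomology of $(\bigwedge\mathfrak{g},\partial)$, $H^*_+(\mathfrak{g})=\sum_{k\ge1}H^k(\mathfrak{g})$ is an algebra without unit for the wedge product. The super Poisson bracket $\{\Omega,\Omega'\}=2(-1)^{w+1}\sum_j\iota_{X_j}(\Omega)\wedge\iota_{X_j}(\Omega')$ ($\Omega\in\bigwedge^w\mathfrak{g}$, $\{X_j\}$ any $B$-orthonormal basis) makes $\bigwedge\mathfrak{g}$, with degree of $\bigwedge^p\mathfrak{g}$ equal to $p-2$, a graded Lie algebra; it induces graded Lie algebra structures on $H^*(\mathfrak{g})$ and on $H_Q^*(\mathfrak{g})=H^*(\mathfrak{g})/\mathbb{C}$.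 $\mathcal{M}_a^0(\mathfrak{g})=\mathfrak{g}$, and for $k\ge1$, $\mathcal{M}_a^k(\mathfrak{g})$ is the space of skew symmetric $k$-linear maps $\mathfrak{g}^k\to\mathfrak{g}$. With $\mathfrak{S}_{p,q}$ the $(p,q)$-unshuffles ($\sigma(1)<\dots<\sigma(p)$, $\sigma(p+1)<\dots<\sigma(p+q)$), for $F\in\mathcal{M}_a^{p+1}(\mathfrak{g})$, $G\in\mathcal{M}_a^{q+1}(\mathfrak{g})$ the Gerstenhaber bracket is $$[F,G]_a(X_1,\dots,X_{p+q+1})=(-1)^{pq}\sum_{\sigma\in\mathfrak{S}_{q+1,p}}\varepsilon(\sigma)F(G(X_{\sigma(1)},\dots,X_{\sigma(q+1)}),X_{\sigma(q+2)},\dots)-\sum_{\sigma\in\mathfrak{S}_{p+1,q}}\varepsilon(\sigma)G(F(X_{\sigma(1)},\dots,X_{\sigma(p+1)}),X_{\sigma(p+2)},\dots).$$ For $C\in\mathcal{M}_a^k(\mathfrak{g})$, $\hat C(Y_1,\dots,Y_{k+1})=B(C(Y_1,\dots,Y_k),Y_{k+1})$ ($\hat C(Y)=B(C,Y)$ if $k=0$). $C$ is a cyclic cochain if $\hat C(Y_1,\dots,Y_{k+1})=(-1)^k\hat C(Y_{k+1},Y_1,\dots,Y_k)$ for all $Y_i$. The space $\mathcal{C}_c(\mathfrak{g})$ of cyclic cochains is stable under $[\cdot,\cdot]_a$ and under $d=[F_0,\cdot]_a$, where $F_0(X,Y)=[X,Y]$ ($d$ is the Chevalley differential of the adjoint cohomology);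 $H_c^*(\mathfrak{g})$ is the cohomology of $(\mathcal{C}_c(\mathfrak{g}),d)$. The bracket $[\cdot,\cdot]_a$ induces a graded Lie algebra structure on $H_c^*(\mathfrak{g})$ (with $H_c^k$ in degree $k-1$). The map $\Phi\colon\mathcal{C}_c(\mathfrak{g})\to\bigwedge_+\mathfrak{g}$, $\Phi(C)=-\frac12\hat C$, is a linear bijection; the product $C\wedge C'=\Phi^{-1}(\Phi(C)\wedge\Phi(C'))$ on $\mathcal{C}_c(\mathfrak{g})$ induces a $\wedge$-product on $H_c^*(\mathfrak{g})$ (graded with $H_c^k$ in degree $k+1$). *)

theory Defs
  imports Complex_Main "HOL-Combinatorics.Permutations"
begin

section \<open>Quadratic Lie algebras\<close>

locale quadratic_lie_algebra = vector_space s
  for s :: "complex \<Rightarrow> 'g::ab_group_add \<Rightarrow> 'g" +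
  fixes br :: "'g \<Rightarrow> 'g \<Rightarrow> 'g"
    and B :: "'g \<Rightarrow> 'g \<Rightarrow> complex"
  assumes finite_dim: "\<exists>S. finite S \<and> span S = UNIV"
    and br_linear_left: "Vector_Spaces.linear s s (\<lambda>x. br x y)"
    and br_linear_right: "Vector_Spaces.linear s s (\<lambda>y. br x y)"
    and br_alternating: "br x x = 0"
    and br_jacobi: "br x (br y z) + br y (br z x) + br z (br x y) = 0"
    and B_linear_left: "Vector_Spaces.linear s (*) (\<lambda>x. B x y)"
    and B_linear_right: "Vector_Spaces.linear s (*) (\<lambda>y. B x y)"
    and B_symmetric: "B x y = B y x"
    and B_invariant: "B (br x y) z = B x (br y z)"
    and B_nondegenerate: "(\<forall>y. B x y = 0) \<Longrightarrow> x = 0"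

definition orthonormal_basis ::
    "(complex \<Rightarrow> 'g::ab_group_add \<Rightarrow> 'g) \<Rightarrow> ('g \<Rightarrow> 'g \<Rightarrow> complex) \<Rightarrow> 'g set \<Rightarrow> bool" where
  "orthonormal_basis s B E \<longleftrightarrow>
     finite E \<and> \<not> module.dependent s E \<and> module.span s E = UNIV \<and>
     (\<forall>x\<in>E. \<forall>y\<in>E. B x y = (if x = y then 1 else 0))"


section \<open>Cochains\<close>

text \<open>A \<open>k\<close>-linear map on \<open>'g\<close> is a function on lists that vanishes off the lists of
  length \<open>k\<close>. A sum of maps of different arities is then a single function on lists, whose
  component of arity \<open>k\<close> is its restriction to the lists of length \<open>k\<close>.\<close>

text \<open>The scalar multiplication \<open>t\<close> of the target is \<open>(*)\<close> for scalar forms and \<open>s\<close> for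
  \<open>'g\<close>-valued maps.\<close>

definition skew_maps ::
    "(complex \<Rightarrow> 'g::ab_group_add \<Rightarrow> 'g) \<Rightarrow> (complex \<Rightarrow> 'v::ab_group_add \<Rightarrow> 'v) \<Rightarrow> nat
      \<Rightarrow> ('g list \<Rightarrow> 'v) set" where
  "skew_maps s t k = {f.
     (\<forall>xs. length xs \<noteq> k \<longrightarrow> f xs = 0) \<and>
     (\<forall>xs i. length xs = k \<longrightarrow> i < k \<longrightarrow> Vector_Spaces.linear s t (\<lambda>x. f (xs[i := x]))) \<and>
     (\<forall>xs \<sigma>. length xs = k \<longrightarrow> \<sigma> permutes {..<k} \<longrightarrow>
        f (permute_list \<sigma> xs) = t (of_int (sign \<sigma>)) (f xs))}"

definition arity_part :: "nat \<Rightarrow> ('g list \<Rightarrow> 'v::zero) \<Rightarrow> 'g list \<Rightarrow> 'v" where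
  "arity_part k f = (\<lambda>xs. if length xs = k then f xs else 0)"

definition skew_maps_sum ::
    "(complex \<Rightarrow> 'g::ab_group_add \<Rightarrow> 'g) \<Rightarrow> (complex \<Rightarrow> 'v::ab_group_add \<Rightarrow> 'v)
      \<Rightarrow> ('g list \<Rightarrow> 'v) set" where
  "skew_maps_sum s t = {f. (\<forall>k. arity_part k f \<in> skew_maps s t k) \<and>
     (\<exists>N. \<forall>xs. N < length xs \<longrightarrow> f xs = 0)}"

text \<open>The spaces \<open>\<Lambda>\<^sup>p\<close>, \<open>\<Lambda>\<close>, \<open>\<Lambda>\<^sub>+\<close> of skew symmetric forms.\<close>

definition forms :: "(complex \<Rightarrow> 'g::ab_group_add \<Rightarrow> 'g) \<Rightarrow> nat \<Rightarrow> ('g list \<Rightarrow> complex) set" where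
  "forms s p = skew_maps s (*) p"

definition all_forms :: "(complex \<Rightarrow> 'g::ab_group_add \<Rightarrow> 'g) \<Rightarrow> ('g list \<Rightarrow> complex) set" where
  "all_forms s = skew_maps_sum s (*)"

definition positive_forms :: "(complex \<Rightarrow> 'g::ab_group_add \<Rightarrow> 'g) \<Rightarrow> ('g list \<Rightarrow> complex) set" where
  "positive_forms s = {\<Omega> \<in> all_forms s. \<Omega> [] = 0}"

definition unshuffles :: "nat \<Rightarrow> nat \<Rightarrow> (nat \<Rightarrow> nat) set" where
  "unshuffles p q = {\<sigma>. \<sigma> permutes {..<p + q} \<and>
     strict_mono_on {..<p} \<sigma> \<and> strict_mono_on {p..<p + q} \<sigma>}"

definition wedge :: "('g list \<Rightarrow> complex) \<Rightarrow> ('g list \<Rightarrow> complex) \<Rightarrow> 'g list \<Rightarrow> complex" where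
  "wedge \<Omega> \<Omega>' xs = (\<Sum>p\<le>length xs. \<Sum>\<sigma>\<in>unshuffles p (length xs - p).
     of_int (sign \<sigma>) * \<Omega> (take p (permute_list \<sigma> xs)) * \<Omega>' (drop p (permute_list \<sigma> xs)))"

definition inner_der :: "'g \<Rightarrow> ('g list \<Rightarrow> complex) \<Rightarrow> 'g list \<Rightarrow> complex" where
  "inner_der X \<Omega> xs = \<Omega> (X # xs)"

definition chevalley_diff ::
    "('g \<Rightarrow> 'g \<Rightarrow> 'g) \<Rightarrow> ('g list \<Rightarrow> complex) \<Rightarrow> 'g list \<Rightarrow> complex" where
  "chevalley_diff br \<Omega> xs = (\<Sum>j<length xs. \<Sum>i<j.
     (-1) ^ (i + j) * \<Omega> (br (xs ! i) (xs ! j) # nths xs (- {i, j})))"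

text \<open>Bilinear extension of
  \<open>{\<Omega>, \<Omega>'} = 2 (-1)\<^sup>w\<^sup>+\<^sup>1 \<Sum>\<^sub>j \<iota>\<^sub>j \<Omega> \<and> \<iota>\<^sub>j \<Omega>'\<close>, \<open>\<Omega> \<in> \<Lambda>\<^sup>w\<close>:
  the sign is absorbed in the first argument, arity by arity.\<close>

definition super_poisson ::
    "'g set \<Rightarrow> ('g list \<Rightarrow> complex) \<Rightarrow> ('g list \<Rightarrow> complex) \<Rightarrow> 'g list \<Rightarrow> complex" where
  "super_poisson E \<Omega> \<Omega>' xs =
     2 * (\<Sum>X\<in>E. wedge (inner_der X (\<lambda>ys. (-1) ^ (length ys + 1) * \<Omega> ys)) (inner_der X \<Omega>') xs)"


section \<open>The Gerstenhaber bracket and cyclic cochains\<close>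

text \<open>For \<open>F\<close> of arity \<open>a\<close> and \<open>G\<close> of arity \<open>b\<close>, the sum over \<open>(b, a - 1)\<close>-unshuffles of
  \<open>\<epsilon>(\<sigma>) F(G(X\<^sub>\<sigma>\<^sub>1, \<dots>, X\<^sub>\<sigma>\<^sub>b), \<dots>)\<close>; there are none if \<open>a = 0\<close>.\<close>

definition insertion_sum ::
    "(complex \<Rightarrow> 'g::ab_group_add \<Rightarrow> 'g) \<Rightarrow> nat \<Rightarrow> nat \<Rightarrow> ('g list \<Rightarrow> 'g) \<Rightarrow> ('g list \<Rightarrow> 'g)
      \<Rightarrow> 'g list \<Rightarrow> 'g" where
  "insertion_sum s a b F G xs = (if a = 0 then 0 else
     \<Sum>\<sigma>\<in>unshuffles b (a - 1). s (of_int (sign \<sigma>))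
       (F (G (take b (permute_list \<sigma> xs)) # drop b (permute_list \<sigma> xs))))"

text \<open>Bilinear extension. The arities \<open>a = p + 1\<close>, \<open>b = q + 1\<close> contribute to lists of length
  \<open>p + q + 1 = a + b - 1\<close>, and \<open>(-1)\<^sup>p\<^sup>q = (-1)\<close> to the power \<open>(a + 1) (b + 1)\<close>.\<close>

definition gerstenhaber ::
    "(complex \<Rightarrow> 'g::ab_group_add \<Rightarrow> 'g) \<Rightarrow> ('g list \<Rightarrow> 'g) \<Rightarrow> ('g list \<Rightarrow> 'g) \<Rightarrow> 'g list \<Rightarrow> 'g" where
  "gerstenhaber s F G xs = (\<Sum>a\<le>length xs + 1. let b = length xs + 1 - a in
     s ((-1) ^ ((a + 1) * (b + 1))) (insertion_sum s a b F G xs) - insertion_sum s b a G F xs)"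

definition hat :: "('g \<Rightarrow> 'g \<Rightarrow> complex) \<Rightarrow> ('g list \<Rightarrow> 'g) \<Rightarrow> 'g list \<Rightarrow> complex" where
  "hat B C ys = (if ys = [] then 0 else B (C (butlast ys)) (last ys))"

definition cyclic :: "('g \<Rightarrow> 'g \<Rightarrow> complex) \<Rightarrow> ('g list \<Rightarrow> 'g) \<Rightarrow> bool" where
  "cyclic B C \<longleftrightarrow> (\<forall>k ys. length ys = k + 1 \<longrightarrow>
     hat B C ys = (-1) ^ k * hat B C (last ys # butlast ys))"

definition cyclic_cochains ::
    "(complex \<Rightarrow> 'g::ab_group_add \<Rightarrow> 'g) \<Rightarrow> ('g \<Rightarrow> 'g \<Rightarrow> complex) \<Rightarrow> nat \<Rightarrow> ('g list \<Rightarrow> 'g) set" where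
  "cyclic_cochains s B k = {C \<in> skew_maps s s k. cyclic B C}"

definition all_cyclic_cochains ::
    "(complex \<Rightarrow> 'g::ab_group_add \<Rightarrow> 'g) \<Rightarrow> ('g \<Rightarrow> 'g \<Rightarrow> complex) \<Rightarrow> ('g list \<Rightarrow> 'g) set" where
  "all_cyclic_cochains s B = {C \<in> skew_maps_sum s s. cyclic B C}"

definition bracket_cochain :: "('g \<Rightarrow> 'g \<Rightarrow> 'g) \<Rightarrow> 'g list \<Rightarrow> 'g::zero" where
  "bracket_cochain br xs = (if length xs = 2 then br (xs ! 0) (xs ! 1) else 0)"

definition adjoint_diff ::
    "(complex \<Rightarrow> 'g::ab_group_add \<Rightarrow> 'g) \<Rightarrow> ('g \<Rightarrow> 'g \<Rightarrow> 'g) \<Rightarrow> ('g list \<Rightarrow> 'g) \<Rightarrow> 'g list \<Rightarrow> 'g" where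
  "adjoint_diff s br C = gerstenhaber s (bracket_cochain br) C"

definition Phi :: "('g \<Rightarrow> 'g \<Rightarrow> complex) \<Rightarrow> ('g list \<Rightarrow> 'g) \<Rightarrow> 'g list \<Rightarrow> complex" where
  "Phi B C = (\<lambda>ys. - (1 / 2) * hat B C ys)"

definition cyclic_wedge ::
    "(complex \<Rightarrow> 'g::ab_group_add \<Rightarrow> 'g) \<Rightarrow> ('g \<Rightarrow> 'g \<Rightarrow> complex)
      \<Rightarrow> ('g list \<Rightarrow> 'g) \<Rightarrow> ('g list \<Rightarrow> 'g) \<Rightarrow> 'g list \<Rightarrow> 'g" where
  "cyclic_wedge s B C C' =
     inv_into (all_cyclic_cochains s B) (Phi B) (wedge (Phi B C) (Phi B C'))"


section \<open>Graded algebras, subalgebras and quotients\<close>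

text \<open>The product may be an associative product or a Lie bracket.\<close>

record 'a graded_alg =
  gcarrier :: "'a set"
  component :: "int \<Rightarrow> 'a set"
  gadd :: "'a \<Rightarrow> 'a \<Rightarrow> 'a"
  gscale :: "complex \<Rightarrow> 'a \<Rightarrow> 'a"
  gmult :: "'a \<Rightarrow> 'a \<Rightarrow> 'a"

definition sub_alg :: "'a graded_alg \<Rightarrow> 'a set \<Rightarrow> 'a graded_alg" where
  "sub_alg A S = A\<lparr>gcarrier := gcarrier A \<inter> S, component := (\<lambda>n. component A n \<inter> S)\<rparr>"

definition gcoset :: "'a graded_alg \<Rightarrow> 'a set \<Rightarrow> 'a \<Rightarrow> 'a set" where
  "gcoset A I x = (\<lambda>y. gadd A x y) ` I"

text \<open>As for \<open>FactRing\<close> in HOL-Algebra, the operation induced on cosets is the union of the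
  cosets of the results over all representatives; it is that common coset whenever the
  operation passes to the quotient.\<close>

definition quot_alg :: "'a graded_alg \<Rightarrow> 'a set \<Rightarrow> 'a set graded_alg" where
  "quot_alg A I = \<lparr>
     gcarrier = gcoset A I ` gcarrier A,
     component = (\<lambda>n. gcoset A I ` component A n),
     gadd = (\<lambda>S T. \<Union>x\<in>S. \<Union>y\<in>T. gcoset A I (gadd A x y)),
     gscale = (\<lambda>c S. \<Union>x\<in>S. gcoset A I (gscale A c x)),
     gmult = (\<lambda>S T. \<Union>x\<in>S. \<Union>y\<in>T. gcoset A I (gmult A x y))\<rparr>"

definition graded_alg_iso :: "'a graded_alg \<Rightarrow> 'b graded_alg \<Rightarrow> ('a \<Rightarrow> 'b) \<Rightarrow> bool" where
  "graded_alg_iso A A' f \<longleftrightarrow>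
     bij_betw f (gcarrier A) (gcarrier A') \<and>
     (\<forall>n. f ` component A n = component A' n) \<and>
     (\<forall>x\<in>gcarrier A. \<forall>y\<in>gcarrier A. f (gadd A x y) = gadd A' (f x) (f y)) \<and>
     (\<forall>c. \<forall>x\<in>gcarrier A. f (gscale A c x) = gscale A' c (f x)) \<and>
     (\<forall>x\<in>gcarrier A. \<forall>y\<in>gcarrier A. f (gmult A x y) = gmult A' (f x) (f y))"

definition graded_alg_isomorphic :: "'a graded_alg \<Rightarrow> 'b graded_alg \<Rightarrow> bool" where
  "graded_alg_isomorphic A A' \<longleftrightarrow> (\<exists>f. graded_alg_iso A A' f)"

text \<open>Cochains \<open>V\<close> with the maps of arity \<open>k\<close> (\<open>W k\<close>) placed in degree \<open>k + d\<close>.\<close>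

definition cochain_alg ::
    "(complex \<Rightarrow> 'v::ab_group_add \<Rightarrow> 'v) \<Rightarrow> ('g list \<Rightarrow> 'v) set \<Rightarrow> (nat \<Rightarrow> ('g list \<Rightarrow> 'v) set) \<Rightarrow> int
      \<Rightarrow> (('g list \<Rightarrow> 'v) \<Rightarrow> ('g list \<Rightarrow> 'v) \<Rightarrow> 'g list \<Rightarrow> 'v) \<Rightarrow> ('g list \<Rightarrow> 'v) graded_alg" where
  "cochain_alg t V W d m = \<lparr>
     gcarrier = V,
     component = (\<lambda>n. if n < d then {\<lambda>_. 0} else W (nat (n - d))),
     gadd = (\<lambda>f g xs. f xs + g xs),
     gscale = (\<lambda>c f xs. t c (f xs)),
     gmult = m\<rparr>"


section \<open>Cohomology\<close>

definition cocycles :: "('g list \<Rightarrow> 'v::zero) set \<Rightarrow> (('g list \<Rightarrow> 'v) \<Rightarrow> 'g list \<Rightarrow> 'v)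
    \<Rightarrow> ('g list \<Rightarrow> 'v) set" where
  "cocycles V D = {f \<in> V. D f = (\<lambda>_. 0)}"

definition cohomology_alg :: "('g list \<Rightarrow> 'v::zero) graded_alg
    \<Rightarrow> (('g list \<Rightarrow> 'v) \<Rightarrow> 'g list \<Rightarrow> 'v) \<Rightarrow> ('g list \<Rightarrow> 'v) set graded_alg" where
  "cohomology_alg A D =
     quot_alg (sub_alg A (cocycles (gcarrier A) D)) (D ` gcarrier A)"

definition forms_alg :: "(complex \<Rightarrow> 'g::ab_group_add \<Rightarrow> 'g) \<Rightarrow> ('g list \<Rightarrow> complex) graded_alg" where
  "forms_alg s = cochain_alg (*) (all_forms s) (forms s) 0 wedge"

definition poisson_alg ::
    "(complex \<Rightarrow> 'g::ab_group_add \<Rightarrow> 'g) \<Rightarrow> 'g set \<Rightarrow> ('g list \<Rightarrow> complex) graded_alg" where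
  "poisson_alg s E = cochain_alg (*) (all_forms s) (forms s) (-2) (super_poisson E)"

definition cyclic_wedge_alg ::
    "(complex \<Rightarrow> 'g::ab_group_add \<Rightarrow> 'g) \<Rightarrow> ('g \<Rightarrow> 'g \<Rightarrow> complex) \<Rightarrow> ('g list \<Rightarrow> 'g) graded_alg" where
  "cyclic_wedge_alg s B =
     cochain_alg s (all_cyclic_cochains s B) (cyclic_cochains s B) 1 (cyclic_wedge s B)"

definition cyclic_lie_alg ::
    "(complex \<Rightarrow> 'g::ab_group_add \<Rightarrow> 'g) \<Rightarrow> ('g \<Rightarrow> 'g \<Rightarrow> complex) \<Rightarrow> ('g list \<Rightarrow> 'g) graded_alg" where
  "cyclic_lie_alg s B =
     cochain_alg s (all_cyclic_cochains s B) (cyclic_cochains s B) (-1) (gerstenhaber s)"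

text \<open>\<open>H\<^sup>*\<^sub>+\<close> as the subalgebra of \<open>H\<^sup>*\<close> of the classes of cocycles without component of degree
  \<open>0\<close>.\<close>

definition H_plus :: "(complex \<Rightarrow> 'g::ab_group_add \<Rightarrow> 'g) \<Rightarrow> ('g \<Rightarrow> 'g \<Rightarrow> 'g)
    \<Rightarrow> ('g list \<Rightarrow> complex) set graded_alg" where
  "H_plus s br = sub_alg (cohomology_alg (forms_alg s) (chevalley_diff br))
     (gcoset (forms_alg s) (chevalley_diff br ` all_forms s) `
        cocycles (positive_forms s) (chevalley_diff br))"

text \<open>\<open>H\<^sub>Q\<^sup>*\<close> is the quotient of \<open>H\<^sup>*\<close>, with the bracket, by the classes of the constants.\<close>

definition H_Q :: "(complex \<Rightarrow> 'g::ab_group_add \<Rightarrow> 'g) \<Rightarrow> ('g \<Rightarrow> 'g \<Rightarrow> 'g) \<Rightarrow> 'g set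
    \<Rightarrow> ('g list \<Rightarrow> complex) set set graded_alg" where
  "H_Q s br E = quot_alg (cohomology_alg (poisson_alg s E) (chevalley_diff br))
     (gcoset (poisson_alg s E) (chevalley_diff br ` all_forms s) ` forms s 0)"

definition Hc_wedge :: "(complex \<Rightarrow> 'g::ab_group_add \<Rightarrow> 'g) \<Rightarrow> ('g \<Rightarrow> 'g \<Rightarrow> 'g)
    \<Rightarrow> ('g \<Rightarrow> 'g \<Rightarrow> complex) \<Rightarrow> ('g list \<Rightarrow> 'g) set graded_alg" where
  "Hc_wedge s br B = cohomology_alg (cyclic_wedge_alg s B) (adjoint_diff s br)"

definition Hc_lie :: "(complex \<Rightarrow> 'g::ab_group_add \<Rightarrow> 'g) \<Rightarrow> ('g \<Rightarrow> 'g \<Rightarrow> 'g)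
    \<Rightarrow> ('g \<Rightarrow> 'g \<Rightarrow> complex) \<Rightarrow> ('g list \<Rightarrow> 'g) set graded_alg" where
  "Hc_lie s br B = cohomology_alg (cyclic_lie_alg s B) (adjoint_diff s br)"

end

theory Submission
  imports Defs "HOL-Library.Function_Algebras" "HOL-Library.Set_Algebras"
begin

text \<open>The map \<open>\<Phi>\<close> is a bijection from cyclic cochains onto forms without constant term; it is
  onto because a nondegenerate form represents every linear functional. It intertwines the two
  differentials. By Parseval in an orthonormal basis, the super Poisson bracket of \<open>\<Phi>(C)\<close> and
  \<open>\<Phi>(C')\<close> is half the alternating sum of \<open>\<plusminus>B(C(\<dots>), C'(\<dots>))\<close> over all splittings of the arguments;
  sorting the splittings by the block that contains the last argument and rotating cyclically
  gives the two halves of the Gerstenhaber bracket. The one discrepancy is a constant, the pairing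
  of the components of degree \<open>1\<close>, which the Gerstenhaber bracket does not see: hence
  \<open>H\<^sub>Q\<close> in place of \<open>H\<^sub>+\<close>.

  Products on a quotient are unions over all representatives, so \<open>\<Phi>\<close> carries them over without
  any use of \<open>\<partial>\<^sup>2 = 0\<close> or of the derivation property. Only the constant has to be independent
  of the representatives, and it is, because coboundaries vanish in degrees \<open>0\<close> and \<open>1\<close>.\<close>

section \<open>Signed sums over the splittings of a list\<close>

text \<open>The products and differentials are sums over unshuffles or index pairs, with signs
  depending on arities. \<open>split_sum\<close> replaces them by one recursion: every entry goes to
  the left or the right block, and a front entry that goes right passes the left block, at the cost
  of \<open>(-1) ^ length A\<close>. Unshuffles are then met only in \<open>sum_unshuffles\<close>
  and the lemmas that lead to it, and arities become block lengths.

  The factor -1/2 in \<Phi> is forced. With t times \<open>hat\<close> in its place, the super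
  Poisson bracket gives 2 t^2 times the sum of the terms
  \<open>(-1) ^ length D * B (C A) (C' D)\<close>, and the Gerstenhaber bracket gives -t times the
  same sum; hence 2 t = -1.

  The Gerstenhaber bracket is tested against a vector z, which becomes the last entry of the list.
  This is why the recursion at the front needs a companion at the end.\<close>

fun split_sum :: "('a list \<Rightarrow> 'a list \<Rightarrow> complex) \<Rightarrow> 'a list \<Rightarrow> complex" where
  "split_sum h [] = h [] []"
| "split_sum h (x # xs) = split_sum (\<lambda>A D. h (x # A) D) xs
     + split_sum (\<lambda>A D. (-1) ^ length A * h A (x # D)) xs"

lemma split_sum_cong:
  assumes "\<And>A D. length A + length D = length xs \<Longrightarrow> h A D = h' A D"
  shows "split_sum h xs = split_sum h' xs"
  using assms
proof (induction xs arbitrary: h h')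
  case (Cons x xs)
  have "split_sum (\<lambda>A. h (x # A)) xs = split_sum (\<lambda>A. h' (x # A)) xs"
    by (rule Cons.IH) (simp add: Cons.prems)
  moreover have "split_sum (\<lambda>A D. (-1) ^ length A * h A (x # D)) xs
      = split_sum (\<lambda>A D. (-1) ^ length A * h' A (x # D)) xs"
    by (rule Cons.IH) (simp add: Cons.prems)
  ultimately show ?case by simp
qed simp

lemma split_sum_add:
  "split_sum (\<lambda>A D. h A D + h' A D) xs = split_sum h xs + split_sum h' xs"
  by (induction xs arbitrary: h h') (simp_all add: distrib_left)

lemma split_sum_zero [simp]: "split_sum (\<lambda>A D. 0) xs = 0"
  by (induction xs) simp_all

lemma split_sum_scale: "split_sum (\<lambda>A D. c * h A D) xs = c * split_sum h xs"
  by (induction xs arbitrary: h) (simp_all add: distrib_left mult.left_commute)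

lemma split_sum_minus: "split_sum (\<lambda>A D. - h A D) xs = - split_sum h xs"
  using split_sum_scale[of "-1" h xs] by simp

lemma split_sum_sum: "split_sum (\<lambda>A D. \<Sum>i\<in>I. h i A D) xs = (\<Sum>i\<in>I. split_sum (h i) xs)"
  by (induction I rule: infinite_finite_induct) (simp_all add: split_sum_add)

text \<open>The last entry reaches the left block only by passing all of \<open>D\<close>, whereas
  it joins the right block in place. The induction over unshuffles and the cyclic rotations both
  work at this end of the list.\<close>

lemma split_sum_snoc:
  "split_sum h (xs @ [z]) = split_sum (\<lambda>A D. (-1) ^ length D * h (A @ [z]) D) xs
     + split_sum (\<lambda>A D. h A (D @ [z])) xs"
proof (induction xs arbitrary: h)
  case (Cons x xs)
  show ?case
    by (simp add: Cons.IH split_sum_minus mult.left_commute)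
qed simp

text \<open>Exchanging two adjacent blocks takes \<open>length A * length D\<close> adjacent
  transpositions.\<close>

lemma split_sum_swap:
  "split_sum (\<lambda>A D. h D A) xs = split_sum (\<lambda>A D. (-1) ^ (length A * length D) * h A D) xs"
proof (induction xs arbitrary: h)
  case (Cons x xs)
  have "(-1) ^ length A * ((-1) ^ (length A * length D) * h (x # A) D) =
      (-1) ^ (length A * length D + length A) * h (x # A) D" for A D
    by (simp add: power_add)
  then show ?case
    using Cons.IH[of "\<lambda>A D. h A (x # D)"] Cons.IH[of "\<lambda>A D. (-1) ^ length D * h (x # A) D"]
    by (simp add: power_add mult_ac power_mult_distrib[symmetric])
qed simp

text \<open>The cycle which moves the entry at position \<open>m\<close> of a list to position \<open>a\<close>.\<close>

definition to_end :: "nat \<Rightarrow> nat \<Rightarrow> nat \<Rightarrow> nat" where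
  "to_end a m i = (if i < a \<or> m < i then i else if i = a then m else i - 1)"

lemma to_end_refl: "to_end a a = id"
  by (auto simp: to_end_def fun_eq_iff)

text \<open>Each step adds one adjacent transposition, so that the permutation property and the sign
  both follow by induction on \<open>m\<close>.\<close>

lemma to_end_Suc: "a \<le> m \<Longrightarrow> to_end a (Suc m) = transpose m (Suc m) \<circ> to_end a m"
  by (auto simp: to_end_def fun_eq_iff transpose_def)

lemma to_end_permutes: "a \<le> m \<Longrightarrow> to_end a m permutes {..<Suc m}"
proof (induction m rule: dec_induct)
  case base
  show ?case by (simp add: to_end_refl permutes_id[unfolded id_def] id_def)
next
  case (step m)
  then show ?case unfolding to_end_Suc[OF step(1)]
    by (intro permutes_compose permutes_swap_id)
      (auto intro: permutes_subset)
qed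

lemma sign_to_end: "a \<le> m \<Longrightarrow> sign (to_end a m) = (-1) ^ (m - a)"
proof (induction m rule: dec_induct)
  case base
  show ?case by (simp add: to_end_refl)
next
  case (step m)
  have "permutation (to_end a m)"
    using to_end_permutes[OF step(1)] permutation_permutes by blast
  then show ?case unfolding to_end_Suc[OF step(1)]
    by (subst sign_compose) (simp_all add: permutation_swap_id sign_swap_id step Suc_diff_le)
qed

lemma permute_list_to_end:
  assumes "a \<le> length ys"
  shows "permute_list (to_end a (length ys)) (ys @ [z]) = take a ys @ z # drop a ys"
proof (rule nth_equalityI)
  show "length (permute_list (to_end a (length ys)) (ys @ [z])) = length (take a ys @ z # drop a ys)"
    using assms by simp
next
  fix i assume "i < length (permute_list (to_end a (length ys)) (ys @ [z]))"
  then show "permute_list (to_end a (length ys)) (ys @ [z]) ! i = (take a ys @ z # drop a ys) ! i"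
    using assms by (cases "i = length ys")
      (auto simp: permute_list_def to_end_def nth_append nth_Cons' min_def)
qed

lemma permute_list_snoc:
  assumes "\<sigma> permutes {..<length xs}"
  shows "permute_list \<sigma> (xs @ [z]) = permute_list \<sigma> xs @ [z]"
proof (rule nth_equalityI)
  fix i assume "i < length (permute_list \<sigma> (xs @ [z]))"
  then show "permute_list \<sigma> (xs @ [z]) ! i = (permute_list \<sigma> xs @ [z]) ! i"
    using permutes_in_image[OF assms, of i] permutes_not_in[OF assms, of i]
    by (auto simp: permute_list_def nth_append less_Suc_eq)
qed simp

section \<open>Unshuffles and the position of the largest index\<close>

lemma finite_unshuffles: "finite (unshuffles p q)"
  by (rule finite_subset[OF _ finite_permutations[of "{..<p + q}"]]) (auto simp: unshuffles_def)

text \<open>The largest index ends the second block. A permutation of an initial segment is a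
  function that fixes everything beyond it, so dropping a fixed last index does not change the
  function, and the two sets are literally equal.\<close>

lemma unshuffles_fix_last:
  "{\<sigma> \<in> unshuffles p (Suc q). \<sigma> (p + q) = p + q} = unshuffles p q"
proof (intro equalityI subsetI CollectI conjI)
  fix \<sigma> assume "\<sigma> \<in> {\<sigma> \<in> unshuffles p (Suc q). \<sigma> (p + q) = p + q}"
  then have s: "\<sigma> permutes {..<Suc (p + q)}" "strict_mono_on {..<p} \<sigma>"
     "strict_mono_on {p..<Suc (p + q)} \<sigma>" "\<sigma> (p + q) = p + q"
    by (auto simp: unshuffles_def)
  have "\<sigma> permutes {..<p + q}"
    by (rule permutes_superset[OF s(1)]) (use s(4) in \<open>auto simp: less_Suc_eq\<close>)
  then show "\<sigma> \<in> unshuffles p q"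
    using s by (auto simp: unshuffles_def strict_mono_on_def)
next
  fix \<sigma> assume "\<sigma> \<in> unshuffles p q"
  then have s: "\<sigma> permutes {..<p + q}" "strict_mono_on {..<p} \<sigma>"
     "strict_mono_on {p..<p + q} \<sigma>"
    by (auto simp: unshuffles_def)
  show l: "\<sigma> (p + q) = p + q"
    using permutes_not_in[OF s(1)] by simp
  have "\<sigma> permutes {..<p + Suc q}"
    by (rule permutes_subset[OF s(1)]) auto
  moreover have "strict_mono_on {p..<p + Suc q} \<sigma>"
    unfolding strict_mono_on_def
  proof (intro allI impI)
    fix i j assume ij: "i \<in> {p..<p + Suc q} \<and> j \<in> {p..<p + Suc q} \<and> i < j"
    show "\<sigma> i < \<sigma> j"
    proof (cases "j = p + q")
      case True
      then show ?thesis using ij l permutes_in_image[OF s(1), of i] by auto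
    next
      case False
      then show ?thesis using ij s(3) by (auto simp: strict_mono_on_def)
    qed
  qed
  ultimately show "\<sigma> \<in> unshuffles p (Suc q)"
    using s by (simp add: unshuffles_def)
qed

lemma unshuffles_move_last:
  "{\<sigma> \<in> unshuffles (Suc p) q. \<sigma> p = p + q} = (\<lambda>\<tau>. \<tau> \<circ> to_end p (p + q)) ` unshuffles p q"
proof (intro equalityI subsetI)
  let ?c = "to_end p (p + q)"
  have c: "?c permutes {..<Suc (p + q)}" by (simp add: to_end_permutes)
  fix \<sigma> assume "\<sigma> \<in> {\<sigma> \<in> unshuffles (Suc p) q. \<sigma> p = p + q}"
  then have s: "\<sigma> permutes {..<Suc (p + q)}" "strict_mono_on {..<Suc p} \<sigma>"
     "strict_mono_on {Suc p..<Suc (p + q)} \<sigma>" "\<sigma> p = p + q"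
    by (auto simp: unshuffles_def)
  \<comment> \<open>This is \<sigma> composed with the inverse cycle, written out: position
    \<open>p\<close> is skipped and the later positions close the gap, which makes monotonicity on
    both blocks visible.\<close>
  define \<tau> where "\<tau> = (\<lambda>i. if i < p \<or> p + q < i then \<sigma> i else if i = p + q then p + q else \<sigma> (Suc i))"
  have "\<tau> = \<sigma> \<circ> Hilbert_Choice.inv ?c"
  proof
    fix i
    obtain j where j: "i = ?c j" using permutes_surj[OF c] by (metis surjD)
    have "\<tau> (?c j) = \<sigma> j"
      using s(4) by (auto simp: \<tau>_def to_end_def)
    then show "\<tau> i = (\<sigma> \<circ> Hilbert_Choice.inv ?c) i"
      by (simp add: j permutes_inverses(2)[OF c])
  qed
  then have "\<sigma> = \<tau> \<circ> ?c" "\<tau> permutes {..<Suc (p + q)}"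
    using permutes_inv_o(2)[OF c] permutes_compose[OF permutes_inv[OF c] s(1)]
    by (simp_all add: comp_assoc)
  moreover have "\<tau> permutes {..<p + q}"
    by (rule permutes_superset[OF calculation(2)]) (auto simp: \<tau>_def less_Suc_eq)
  moreover have "strict_mono_on {..<p} \<tau>" "strict_mono_on {p..<p + q} \<tau>"
    using s(2,3) by (auto simp: \<tau>_def strict_mono_on_def)
  ultimately show "\<sigma> \<in> (\<lambda>\<tau>. \<tau> \<circ> ?c) ` unshuffles p q"
    by (auto simp: unshuffles_def)
next
  let ?c = "to_end p (p + q)"
  have c: "?c permutes {..<Suc (p + q)}" by (simp add: to_end_permutes)
  fix \<sigma> assume "\<sigma> \<in> (\<lambda>\<tau>. \<tau> \<circ> ?c) ` unshuffles p q"
  then obtain \<tau> where \<tau>: "\<sigma> = \<tau> \<circ> ?c" "\<tau> permutes {..<p + q}" "strict_mono_on {..<p} \<tau>"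
     "strict_mono_on {p..<p + q} \<tau>"
    by (auto simp: unshuffles_def)
  have last: "\<tau> (p + q) = p + q"
    using permutes_not_in[OF \<tau>(2)] by simp
  have lt: "\<tau> i < p + q" if "i < p + q" for i
    using permutes_in_image[OF \<tau>(2), of i] that by simp
  have "\<sigma> permutes {..<Suc (p + q)}"
    unfolding \<tau>(1) by (rule permutes_compose[OF c]) (auto intro: permutes_subset[OF \<tau>(2)])
  moreover have "strict_mono_on {..<Suc p} \<sigma>"
    using \<tau>(3) lt last by (auto simp: strict_mono_on_def \<tau>(1) to_end_def)
  moreover have "strict_mono_on {Suc p..<Suc (p + q)} \<sigma>"
    unfolding strict_mono_on_def
  proof (intro allI impI)
    fix i j assume "i \<in> {Suc p..<Suc (p + q)} \<and> j \<in> {Suc p..<Suc (p + q)} \<and> i < j"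
    moreover from this have "\<tau> (i - 1) < \<tau> (j - 1)"
      by (intro strict_mono_onD[OF \<tau>(4)]) auto
    ultimately show "\<sigma> i < \<sigma> j"
      by (auto simp: \<tau>(1) to_end_def)
  qed
  moreover have "\<sigma> p = p + q"
    by (simp add: \<tau>(1) to_end_def last)
  ultimately show "\<sigma> \<in> {\<sigma> \<in> unshuffles (Suc p) q. \<sigma> p = p + q}"
    by (simp add: unshuffles_def)
qed

text \<open>The preimage of the largest index \<open>m\<close> lies in one of the two blocks, and an
  increasing block takes its maximum at its end.\<close>

lemma unshuffles_last_cases:
  assumes "\<sigma> \<in> unshuffles p q" "p + q = Suc m"
  shows "(\<exists>p'. p = Suc p' \<and> \<sigma> p' = m) \<or> ((\<exists>q'. q = Suc q') \<and> \<sigma> m = m)"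
proof -
  have s: "\<sigma> permutes {..<Suc m}" "strict_mono_on {..<p} \<sigma>" "strict_mono_on {p..<Suc m} \<sigma>"
    using assms by (auto simp: unshuffles_def)
  obtain i where i: "\<sigma> i = m" using permutes_surj[OF s(1)] by (metis surjD)
  then have im: "i < Suc m" using permutes_in_image[OF s(1), of i] by simp
  have le: "\<sigma> j \<le> m" if "j < Suc m" for j
    using permutes_in_image[OF s(1), of j] that by simp
  show ?thesis
  proof (cases "i < p")
    case True
    have "\<not> Suc i < p"
      using s(2) i le[of "Suc i"] True assms(2)
      by (auto simp: strict_mono_on_def) (metis Suc_lessD lessI linorder_not_le)
    then show ?thesis using True i by (metis Suc_lessI)
  next
    case False
    have "i = m"
    proof (rule ccontr)
      assume "i \<noteq> m"
      then have "\<sigma> i < \<sigma> m"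
        using s(3) im False by (auto simp: strict_mono_on_def)
      then show False using i le[of m] by simp
    qed
    then show ?thesis using False i assms(2) by (cases q) auto
  qed
qed

text \<open>The recursion is on the last index, since an unshuffle puts it at the end of one of its two
  blocks.\<close>

lemma sum_unshuffles:
  assumes "length xs = p + q"
  shows "(\<Sum>\<sigma>\<in>unshuffles p q. of_int (sign \<sigma>) *
      h (take p (permute_list \<sigma> xs)) (drop p (permute_list \<sigma> xs)))
    = split_sum (\<lambda>A D. if length A = p then h A D else 0) xs"
  using assms
proof (induction xs arbitrary: p q h rule: rev_induct)
  case Nil
  then have "p = 0" "q = 0" by auto
  moreover have "unshuffles 0 0 = {id}"
    by (auto simp: unshuffles_def strict_mono_on_def)
  ultimately show ?case by simp
next
  case (snoc z xs)
  define m where "m = length xs"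
  have pq: "p + q = Suc m" using snoc.prems by (simp add: m_def)
  let ?f = "\<lambda>\<sigma>. of_int (sign \<sigma>) *
      h (take p (permute_list \<sigma> (xs @ [z]))) (drop p (permute_list \<sigma> (xs @ [z])))"
  let ?S1 = "{\<sigma> \<in> unshuffles p q. \<exists>p'. p = Suc p' \<and> \<sigma> p' = m}"
  let ?S2 = "{\<sigma> \<in> unshuffles p q. (\<exists>q'. q = Suc q') \<and> \<sigma> m = m}"
  have U: "unshuffles p q = ?S1 \<union> ?S2"
    using unshuffles_last_cases[OF _ pq] by blast
  have disj: "?S1 \<inter> ?S2 = {}"
  proof -
    have False if "\<sigma> \<in> ?S1" "\<sigma> \<in> ?S2" for \<sigma>
    proof -
      from that obtain p' where p': "p = Suc p'" "\<sigma> p' = \<sigma> m" "q \<noteq> 0" and "\<sigma> permutes {..<p + q}"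
        by (auto simp: unshuffles_def)
      then have "p' = m" by (metis injD permutes_inj)
      then show False using p' pq by simp
    qed
    then show ?thesis by blast
  qed
  \<comment> \<open>Here the new entry ends the left block. The cycle has sign
    \<open>(-1) ^ q\<close>, and \<open>q\<close> is the length of \<open>D\<close> in every
    splitting that contributes.\<close>
  have 1: "sum ?f ?S1 = split_sum (\<lambda>A D. (-1) ^ length D *
      (if length (A @ [z]) = p then h (A @ [z]) D else 0)) xs"
  proof (cases p)
    case 0
    then show ?thesis by simp
  next
    case (Suc p')
    let ?c = "to_end p' m"
    have m: "m = p' + q" using Suc pq by simp
    have c: "?c permutes {..<Suc m}" "sign ?c = (-1) ^ q"
      using to_end_permutes[of p' m] sign_to_end[of p' m] m by auto
    have S1: "?S1 = (\<lambda>\<tau>. \<tau> \<circ> ?c) ` unshuffles p' q"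
      using unshuffles_move_last[of p' q] by (simp add: Suc m)
    have inj: "inj_on (\<lambda>\<tau>. \<tau> \<circ> ?c) (unshuffles p' q)"
      by (rule inj_onI) (metis permutes_surj[OF c(1)] surj_fun_eq)
    have "?f (\<tau> \<circ> ?c) = of_int (sign \<tau>) * ((-1) ^ q * h (take p' (permute_list \<tau> xs) @ [z])
         (drop p' (permute_list \<tau> xs)))" if "\<tau> \<in> unshuffles p' q" for \<tau>
    proof -
      have \<tau>: "\<tau> permutes {..<length xs}" using that by (simp add: unshuffles_def m m_def[symmetric])
      have "permute_list (\<tau> \<circ> ?c) (xs @ [z]) = permute_list ?c (permute_list \<tau> (xs @ [z]))"
        by (rule permute_list_compose) (simp add: c(1) m_def[symmetric])
      also have "\<dots> = take p' (permute_list \<tau> xs) @ z # drop p' (permute_list \<tau> xs)"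
        unfolding permute_list_snoc[OF \<tau>]
        using permute_list_to_end[of p' "permute_list \<tau> xs" z] m by (simp add: m_def)
      finally have "permute_list (\<tau> \<circ> ?c) (xs @ [z])
          = take p' (permute_list \<tau> xs) @ z # drop p' (permute_list \<tau> xs)" .
      moreover have "sign (\<tau> \<circ> ?c) = sign \<tau> * (-1) ^ q"
        using \<tau> c by (subst sign_compose) (auto simp: permutation_permutes)
      moreover have "p' \<le> length xs" using m m_def by simp
      ultimately show ?thesis by (simp add: Suc)
    qed
    then have "sum ?f ?S1 = (\<Sum>\<tau>\<in>unshuffles p' q. of_int (sign \<tau>) * ((-1) ^ q *
         h (take p' (permute_list \<tau> xs) @ [z]) (drop p' (permute_list \<tau> xs))))"
      unfolding S1 sum.reindex[OF inj] by (intro sum.cong) auto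
    also have "\<dots> = split_sum (\<lambda>A D. if length A = p' then (-1) ^ q * h (A @ [z]) D else 0) xs"
      using snoc.IH[of p' q "\<lambda>A D. (-1) ^ q * h (A @ [z]) D"] m m_def by simp
    also have "\<dots> = split_sum (\<lambda>A D. (-1) ^ length D *
      (if length (A @ [z]) = p then h (A @ [z]) D else 0)) xs"
      by (rule split_sum_cong) (use m m_def Suc in auto)
    finally show ?thesis .
  qed
  \<comment> \<open>Here the new entry stays last and costs no sign. For \<open>q = 0\<close> there
    are no such unshuffles, and no splitting of \<open>xs\<close> has a left block of length
    \<open>p = m + 1\<close>.\<close>
  have 2: "sum ?f ?S2 = split_sum (\<lambda>A D. if length A = p then h A (D @ [z]) else 0) xs"
  proof (cases q)
    case 0
    have "split_sum (\<lambda>A D. if length A = p then h A (D @ [z]) else 0) xs = split_sum (\<lambda>A D. 0) xs"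
      by (rule split_sum_cong) (use 0 pq m_def in auto)
    then show ?thesis by (simp add: 0)
  next
    case (Suc q')
    have m: "m = p + q'" using Suc pq by simp
    have S2: "?S2 = unshuffles p q'"
      using unshuffles_fix_last[of p q'] by (simp add: Suc m)
    have "?f \<sigma> = of_int (sign \<sigma>) *
        h (take p (permute_list \<sigma> xs)) (drop p (permute_list \<sigma> xs) @ [z])"
      if "\<sigma> \<in> unshuffles p q'" for \<sigma>
    proof -
      have \<sigma>: "\<sigma> permutes {..<length xs}" using that by (simp add: unshuffles_def m m_def[symmetric])
      show ?thesis unfolding permute_list_snoc[OF \<sigma>] using m m_def by simp
    qed
    then have "sum ?f ?S2 = (\<Sum>\<sigma>\<in>unshuffles p q'. of_int (sign \<sigma>) *
        h (take p (permute_list \<sigma> xs)) (drop p (permute_list \<sigma> xs) @ [z]))"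
      unfolding S2 by (intro sum.cong) auto
    then show ?thesis
      using snoc.IH[of p q' "\<lambda>A D. h A (D @ [z])"] m m_def by simp
  qed
  have "sum ?f (unshuffles p q) = sum ?f ?S1 + sum ?f ?S2"
    using finite_unshuffles[of p q] disj
    by (subst U, intro sum.union_disjoint) auto
  also have "\<dots> = split_sum (\<lambda>A D. if length A = p then h A D else 0) (xs @ [z])"
    unfolding split_sum_snoc 1 2 by simp
  finally show ?case .
qed

text \<open>Each splitting counts for the single arity \<open>p = length A\<close>. Coefficients
  that depend on the arity thereby become functions of the block length.\<close>

lemma split_sum_by_length:
  "(\<Sum>p\<le>length xs. split_sum (\<lambda>A D. if length A = p then h p A D else 0) xs)
    = split_sum (\<lambda>A D. h (length A) A D) xs"
proof -
  have "split_sum (\<lambda>A D. h (length A) A D) xs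
      = split_sum (\<lambda>A D. \<Sum>p\<le>length xs. if length A = p then h p A D else 0) xs"
    by (rule split_sum_cong) auto
  then show ?thesis by (simp only: split_sum_sum)
qed

section \<open>Wedge product and Chevalley differential as signed sums\<close>

lemma wedge_split_sum: "wedge \<Omega> \<Omega>' xs = split_sum (\<lambda>A D. \<Omega> A * \<Omega>' D) xs"
proof -
  have "wedge \<Omega> \<Omega>' xs
      = (\<Sum>p\<le>length xs. split_sum (\<lambda>A D. if length A = p then \<Omega> A * \<Omega>' D else 0) xs)"
    unfolding wedge_def
    by (intro sum.cong refl)
      (use sum_unshuffles[of xs _ _ "\<lambda>A D. \<Omega> A * \<Omega>' D"] in \<open>simp add: mult.assoc\<close>)
  then show ?thesis using split_sum_by_length[where h="\<lambda>p A D. \<Omega> A * \<Omega>' D"] by simp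
qed

text \<open>An entry taken from position \<open>j\<close> passes the \<open>j\<close> entries before
  it. This serves the inductive step for the selection of two entries in the Chevalley
  differential.\<close>

lemma split_sum_length_1:
  "split_sum (\<lambda>A D. if length A = 1 then h (A ! 0) D else 0) xs
    = (\<Sum>j<length xs. (-1) ^ j * h (xs ! j) (nths xs (- {j})))"
proof (induction xs arbitrary: h)
  case (Cons x xs)
  have 0: "split_sum (\<lambda>A D. if length (x # A) = 1 then h ((x # A) ! 0) D else 0) xs = h x xs"
  proof -
    have *: "split_sum (\<lambda>A D. if A = [] then k D else 0) ys = k ys" for ys :: "'a list" and k
    proof (induction ys arbitrary: k)
      case (Cons y ys)
      have "split_sum (\<lambda>A D. (-1) ^ length A * (if A = [] then k (y # D) else 0)) ys =
          split_sum (\<lambda>A D. if A = [] then k (y # D) else 0) ys"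
        by (rule split_sum_cong) simp
      then show ?case by (simp add: Cons)
    qed simp
    show ?thesis unfolding *[of "h x" xs, symmetric] by (rule split_sum_cong) auto
  qed
  have 1: "split_sum (\<lambda>A D. (-1) ^ length A * (if length A = 1 then h (A ! 0) (x # D) else 0)) xs
      = split_sum (\<lambda>A D. if length A = 1 then - h (A ! 0) (x # D) else 0) xs"
    by (rule split_sum_cong) simp
  have [simp]: "{j. Suc j \<noteq> Suc i} = - {i}" "{j. j \<noteq> i} = - {i}" for i :: nat by auto
  have [simp]: "nths xs UNIV = xs" by (simp add: nths_all)
  show ?case
    unfolding split_sum.simps(2) 0 1
    unfolding Cons.IH[of "\<lambda>u D. - h u (x # D)"] length_Cons sum.lessThan_Suc_shift
    by (simp add: nths_Cons sum_negf)
qed simp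

text \<open>Moving the entries \<open>i < j\<close> to the front takes \<open>i + (j - 1)\<close>
  transpositions, whereas the definition carries \<open>(-1) ^ (i + j)\<close>; hence the minus
  sign.\<close>

lemma chevalley_diff_split_sum:
  "chevalley_diff br \<Omega> xs
    = - split_sum (\<lambda>A D. if length A = 2 then \<Omega> (br (A ! 0) (A ! 1) # D) else 0) xs"
proof -
  \<comment> \<open>The induction needs a general \<open>k\<close>: an entry that is not selected
    joins the remaining list, behind the slot of the bracket.\<close>
  have *: "(\<Sum>j<length xs. \<Sum>i<j. (-1) ^ (i + j) * k (xs ! i) (xs ! j) (nths xs (- {i, j})))
    = - split_sum (\<lambda>A D. if length A = 2 then k (A ! 0) (A ! 1) D else 0) xs"
    for k :: "'a \<Rightarrow> 'a \<Rightarrow> 'a list \<Rightarrow> complex"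
  proof (induction xs arbitrary: k)
    case (Cons x xs)
    have "split_sum (\<lambda>A D. if length (x # A) = 2 then k ((x # A) ! 0) ((x # A) ! 1) D else 0) xs
        = split_sum (\<lambda>A D. if length A = 1 then k x (A ! 0) D else 0) xs"
      by (rule split_sum_cong) simp
    moreover have "split_sum (\<lambda>A D. (-1) ^ length A *
          (if length A = 2 then k (A ! 0) (A ! 1) (x # D) else 0)) xs
        = split_sum (\<lambda>A D. if length A = 2 then k (A ! 0) (A ! 1) (x # D) else 0) xs"
      by (rule split_sum_cong) simp
    moreover have [simp]: "{j. Suc j \<noteq> Suc i} = - {i}" "{j. j \<noteq> i} = - {i}" for i :: nat by auto
    moreover have [simp]: "{l. l \<noteq> i \<and> l \<noteq> j} = - {i, j}" for i j :: nat by auto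
    ultimately show ?case
      using split_sum_length_1[of "k x" xs] Cons.IH[of "\<lambda>u v D. k u v (x # D)"]
      by (simp add: sum.lessThan_Suc_shift nths_Cons sum.distrib sum_negf sum_subtractf del: sum.lessThan_Suc)
  qed simp
  show ?thesis unfolding chevalley_diff_def by (rule *[of "\<lambda>u v D. \<Omega> (br u v # D)"])
qed

section \<open>Alternating functions on lists\<close>

text \<open>No arity is imposed: the conditions hold separately on the lists of each length.\<close>

definition alternating ::
    "(complex \<Rightarrow> 'g::ab_group_add \<Rightarrow> 'g) \<Rightarrow> ('g list \<Rightarrow> complex) \<Rightarrow> bool" where
  "alternating s f \<longleftrightarrow>
     (\<forall>us vs x y. f (us @ (x + y) # vs) = f (us @ x # vs) + f (us @ y # vs)) \<and>
     (\<forall>us vs c x. f (us @ s c x # vs) = c * f (us @ x # vs)) \<and>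
     (\<forall>us vs x y. f (us @ x # y # vs) = - f (us @ y # x # vs))"

lemma alternatingD:
  assumes "alternating s f"
  shows "f (us @ (x + y) # vs) = f (us @ x # vs) + f (us @ y # vs)"
    "f (us @ s c x # vs) = c * f (us @ x # vs)"
    "f (us @ x # y # vs) = - f (us @ y # x # vs)"
  using assms unfolding alternating_def by blast+

lemma alternatingI:
  assumes "\<And>us vs x y. f (us @ (x + y) # vs) = f (us @ x # vs) + f (us @ y # vs)"
    "\<And>us vs c x. f (us @ s c x # vs) = c * f (us @ x # vs)"
    "\<And>us vs x y. f (us @ x # y # vs) = - f (us @ y # x # vs)"
  shows "alternating s f"
  using assms unfolding alternating_def by blast

lemma alternating_Nil_D:
  assumes "alternating s f"
  shows "f ((x + y) # vs) = f (x # vs) + f (y # vs)"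
    "f (s c x # vs) = c * f (x # vs)"
    "f (x # y # vs) = - f (y # x # vs)"
  using alternatingD(1)[OF assms, of "[]" x y vs] alternatingD(2)[OF assms, of "[]" c x vs]
    alternatingD(3)[OF assms, of "[]" x y vs] by simp_all

lemma alternating_Cons: 
  assumes "alternating s f"
  shows "alternating s (\<lambda>A. f (x # A))"
proof (rule alternatingI)
  fix us vs y z c
  note D = alternatingD[OF assms, where us = "x # us"]
  show "f (x # us @ (y + z) # vs) = f (x # us @ y # vs) + f (x # us @ z # vs)"
    using D(1)[of y z vs] by simp
  show "f (x # us @ s c y # vs) = c * f (x # us @ y # vs)"
    using D(2)[of c y vs] by simp
  show "f (x # us @ y # z # vs) = - f (x # us @ z # y # vs)"
    using D(3)[of y z vs] by simp
qed

text \<open>All the conditions compare values on lists of one length, so a coefficient depending on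
  the length is harmless. This is how the signs in the recursion of \<open>split_sum\<close> are
  carried along.\<close>

lemma alternating_scale_length:
  assumes "alternating s f"
  shows "alternating s (\<lambda>A. c (length A) * f A)"
proof (rule alternatingI)
  fix us vs x y
  show "c (length (us @ x # y # vs)) * f (us @ x # y # vs)
      = - (c (length (us @ y # x # vs)) * f (us @ y # x # vs))"
    using alternatingD(3)[OF assms, of us x y vs] by simp
qed (simp_all add: alternatingD(1,2)[OF assms] distrib_left)

lemma alternating_scale: "alternating s f \<Longrightarrow> alternating s (\<lambda>A. c * f A)"
  by (rule alternating_scale_length)

lemma alternating_add:
  assumes f: "alternating s f" and g: "alternating s g"
  shows "alternating s (\<lambda>A. f A + g A)"
proof (rule alternatingI)
  fix us vs x y
  show "f (us @ x # y # vs) + g (us @ x # y # vs) = - (f (us @ y # x # vs) + g (us @ y # x # vs))"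
    using alternatingD(3)[OF f, of us x y vs] alternatingD(3)[OF g, of us x y vs] by simp
qed (simp_all add: alternatingD(1,2)[OF f] alternatingD(1,2)[OF g] distrib_left)

lemma alternating_minus: "alternating s (\<lambda>A. - f A) \<longleftrightarrow> alternating s f"
  using alternating_scale[of s f "-1"] alternating_scale[of s "\<lambda>A. - f A" "-1"] by auto

lemma alternating_zero: "alternating s (\<lambda>A. 0)"
  unfolding alternating_def by simp

lemma alternating_if_length:
  assumes "alternating s f"
  shows "alternating s (\<lambda>A. if length A = n then f A else 0)"
proof -
  have "(\<lambda>A. if length A = n then f A else 0) = (\<lambda>A. (if length A = n then 1 else 0) * f A)"
    by auto
  then show ?thesis
    using alternating_scale_length[OF assms, of "\<lambda>m. if m = n then 1 else 0"] by simp
qed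

lemma alternating_iff_arities:
  "alternating s f \<longleftrightarrow> (\<forall>k. alternating s (arity_part k f))"
proof
  assume *: "\<forall>k. alternating s (arity_part k f)"
  have "f (us @ (x + y) # vs) = f (us @ x # vs) + f (us @ y # vs)"
    "f (us @ s c x # vs) = c * f (us @ x # vs)" for us vs x y c
    using alternatingD(1,2)[OF *[THEN spec, of "length us + Suc (length vs)"], of us _ _ vs]
    by (simp_all add: arity_part_def)
  moreover have "f (us @ x # y # vs) = - f (us @ y # x # vs)" for us vs x y
    using alternatingD(3)[OF *[THEN spec, of "length us + Suc (Suc (length vs))"], of us x y vs]
    by (simp add: arity_part_def)
  ultimately show "alternating s f"
    by (intro alternatingI)
qed (simp add: arity_part_def alternating_if_length)

text \<open>Induction on the prefix \<open>us\<close>: an entry of \<open>us\<close> is put into a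
  block, possibly with a sign depending on the length, and both hypotheses survive this. The content
  lies in the empty prefix.\<close>

lemma alternating_split_sum:
  assumes "\<And>D. alternating s (\<lambda>A. h A D)" "\<And>A. alternating s (\<lambda>D. h A D)"
  shows "alternating s (split_sum h)"
  unfolding alternating_def
proof (intro conjI allI)
  fix us vs x y c
  note sgn = alternating_scale_length[where c="\<lambda>n. (-1) ^ n"]
  show "split_sum h (us @ (x + y) # vs) = split_sum h (us @ x # vs) + split_sum h (us @ y # vs)"
    using assms
  proof (induction us arbitrary: h)
    case Nil
    have "split_sum (\<lambda>A. h ((x + y) # A)) vs = split_sum (\<lambda>A D. h (x # A) D + h (y # A) D) vs"
      "split_sum (\<lambda>A D. (-1) ^ length A * h A ((x + y) # D)) vs
        = split_sum (\<lambda>A D. (-1) ^ length A * h A (x # D) + (-1) ^ length A * h A (y # D)) vs"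
      by (auto intro!: split_sum_cong
          simp: alternating_Nil_D(1)[OF Nil(1)] alternating_Nil_D(1)[OF Nil(2)] distrib_left)
    then show ?case
      by (simp add: split_sum_add)
  next
    case (Cons u us)
    show ?case
      using Cons.IH[of "\<lambda>A D. h (u # A) D"] Cons.IH[of "\<lambda>A D. (-1) ^ length A * h A (u # D)"]
        alternating_Cons[OF Cons.prems(1)] alternating_Cons[OF Cons.prems(2)]
        sgn[OF Cons.prems(1)] alternating_scale[OF Cons.prems(2)]
        alternating_scale[OF alternating_Cons[OF Cons.prems(2)]] Cons.prems
      by simp
  qed
  show "split_sum h (us @ s c x # vs) = c * split_sum h (us @ x # vs)"
    using assms
  proof (induction us arbitrary: h)
    case Nil
    have "split_sum (\<lambda>A. h (s c x # A)) vs = split_sum (\<lambda>A D. c * h (x # A) D) vs"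
      "split_sum (\<lambda>A D. (-1) ^ length A * h A (s c x # D)) vs
        = split_sum (\<lambda>A D. c * ((-1) ^ length A * h A (x # D))) vs"
      by (auto intro!: split_sum_cong
          simp: alternating_Nil_D(2)[OF Nil(1)] alternating_Nil_D(2)[OF Nil(2)])
    then show ?case
      by (simp add: split_sum_scale distrib_left)
  next
    case (Cons u us)
    show ?case
      using Cons.IH[of "\<lambda>A D. h (u # A) D"] Cons.IH[of "\<lambda>A D. (-1) ^ length A * h A (u # D)"]
        alternating_Cons[OF Cons.prems(1)]
        sgn[OF Cons.prems(1)]
        alternating_scale[OF alternating_Cons[OF Cons.prems(2)]] Cons.prems
      by (simp add: distrib_left)
  qed
  show "split_sum h (us @ x # y # vs) = - split_sum h (us @ y # x # vs)"
    using assms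
  proof (induction us arbitrary: h)
    case Nil
    \<comment> \<open>Four placements of \<open>x\<close> and \<open>y\<close> occur. If both are in
      one block, the hypothesis on that block changes the sign; the two mixed placements carry
      opposite signs in the recursion and are interchanged.\<close>
    have 1: "h (x # y # A) D = - h (y # x # A) D" for A D
      by (rule alternating_Nil_D(3)[OF Nil(1)])
    have 2: "h A (x # y # D) = - h A (y # x # D)" for A D
      by (rule alternating_Nil_D(3)[OF Nil(2)])
    have "split_sum (\<lambda>A. h (x # y # A)) vs = split_sum (\<lambda>A D. - h (y # x # A) D) vs"
      "split_sum (\<lambda>A D. (-1) ^ length A * ((-1) ^ length A * h A (x # y # D))) vs
        = split_sum (\<lambda>A D. - ((-1) ^ length A * ((-1) ^ length A * h A (y # x # D)))) vs"
      by (auto intro!: split_sum_cong simp: 1 2)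
    then show ?case
      by (simp add: split_sum_minus)
  next
    case (Cons u us)
    show ?case
      using Cons.IH[of "\<lambda>A D. h (u # A) D"] Cons.IH[of "\<lambda>A D. (-1) ^ length A * h A (u # D)"]
        alternating_Cons[OF Cons.prems(1)]
        sgn[OF Cons.prems(1)]
        alternating_scale[OF alternating_Cons[OF Cons.prems(2)]] Cons.prems
      by simp
  qed
qed

lemma alternating_rotate:
  assumes "alternating s f"
  shows "f (us @ x # vs) = (-1) ^ length us * f (x # us @ vs)"
proof (induction us arbitrary: vs rule: rev_induct)
  case (snoc u us)
  then show ?case
    using alternatingD(3)[OF assms, of us u x vs] snoc[of "u # vs"] by simp
qed simp

section \<open>From adjacent exchanges to arbitrary permutations\<close>

lemma permute_list_transpose_Suc:
  "permute_list (transpose (length us) (Suc (length us))) (us @ x # y # vs) = us @ y # x # vs"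
proof (rule nth_equalityI)
  fix i assume "i < length (permute_list (transpose (length us) (Suc (length us))) (us @ x # y # vs))"
  then have i: "i < length us + Suc (Suc (length vs))" by simp
  show "permute_list (transpose (length us) (Suc (length us))) (us @ x # y # vs) ! i
      = (us @ y # x # vs) ! i"
  proof -
    consider "i < length us" | "i = length us" | "i = Suc (length us)" | j where "i = length us + Suc (Suc j)"
      by (metis add_Suc_right less_iff_Suc_add linorder_neqE_nat not_less_eq)
    then show ?thesis
      using i by cases (simp_all add: permute_list_def nth_append transpose_def del: upt_Suc)
  qed
qed simp

text \<open>Adjacent transpositions generate the symmetric group and the sign is multiplicative.
  This links \<open>alternating\<close> to the definition of \<open>skew_maps\<close> through all
  permutations.\<close>

lemma alternating_permute:
  assumes alt: "alternating s f" and "\<sigma> permutes {..<length xs}"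
  shows "f (permute_list \<sigma> xs) = of_int (sign \<sigma>) * f xs"
proof -
  define k where "k = length xs"
  \<comment> \<open>The list is quantified inside \<open>?P\<close>, because a composition applies
    its second factor to a list that is already permuted.\<close>
  let ?P = "\<lambda>\<sigma>. \<forall>xs. length xs = k \<longrightarrow> f (permute_list \<sigma> xs) = of_int (sign \<sigma>) * f xs"
  have comp: "?P (\<sigma> \<circ> \<tau>)"
    if "?P \<sigma>" "?P \<tau>" "\<sigma> permutes {..<k}" "\<tau> permutes {..<k}" for \<sigma> \<tau>
  proof (intro allI impI)
    fix xs :: "'a list" assume "length xs = k"
    moreover have "sign (\<sigma> \<circ> \<tau>) = sign \<sigma> * sign \<tau>"
      using that(3,4) by (intro sign_compose) (auto simp: permutation_permutes)
    ultimately show "f (permute_list (\<sigma> \<circ> \<tau>) xs) = of_int (sign (\<sigma> \<circ> \<tau>)) * f xs"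
      using that by (simp add: permute_list_compose)
  qed
  have adj: "?P (transpose i (Suc i))" if "Suc i < k" for i
  proof (intro allI impI)
    fix xs :: "'a list" assume l: "length xs = k"
    define us vs where "us = take i xs" and "vs = drop (Suc (Suc i)) xs"
    have "xs = us @ xs ! i # xs ! Suc i # vs" and len: "length us = i"
      using that l by (simp_all add: us_def vs_def id_take_nth_drop Cons_nth_drop_Suc)
    then obtain x y where xs: "xs = us @ x # y # vs" by blast
    show "f (permute_list (transpose i (Suc i)) xs) = of_int (sign (transpose i (Suc i))) * f xs"
      using permute_list_transpose_Suc[of us x y vs] alternatingD(3)[OF alt, of us x y vs]
      by (simp add: xs len sign_swap_id)
  qed
  have perm: "transpose i j permutes {..<k}" if "i < k" "j < k" for i j
    using that by (intro permutes_swap_id) auto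
  have trans: "?P (transpose i j)" if "i < j" "j < k" for i j
    using that
  proof (induction j rule: less_induct)
    case (less j)
    show ?case
    proof (cases "j = Suc i")
      case True
      then show ?thesis using adj less.prems by simp
    next
      case False
      then obtain m where m: "j = Suc m" "i < m" using less.prems
        by (metis gr_implies_not0 less_Suc_eq not0_implies_Suc)
      \<comment> \<open>Conjugation by an adjacent transposition shortens the distance between the
        two exchanged indices.\<close>
      have "transpose i j = transpose m j \<circ> transpose i m \<circ> transpose m j"
        using m by (auto simp: fun_eq_iff transpose_def)
      moreover have "?P (transpose m j \<circ> transpose i m \<circ> transpose m j)"
        using less m adj[of m] by (intro comp permutes_compose perm) auto
      ultimately show ?thesis by (simp only:)
    qed
  qed
  have "?P \<sigma>"
    using assms(2)[folded k_def] finite_lessThan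
  proof (induction rule: permutes_induct)
    case (swap a b p)
    then show ?case
      using trans[of a b] trans[of b a] transpose_commute[of a b]
      by (intro comp perm) (auto simp: neq_iff)
  qed simp
  then show ?thesis by (simp add: k_def)
qed

section \<open>Cohomology algebras as sets of cosets\<close>

lemma UN_set_plus: "(\<Union>x\<in>S. f x + I) = (\<Union>x\<in>S. f x) + I"
  by (auto simp: set_plus_def)

lemma singleton_image_set_plus: "(+) x ` I = {x} + I"
  by (auto simp: set_plus_def)

lemma set_plus_singletons: "{a} + {b} = {a + b}"
  by (auto simp: set_plus_def)

lemma image_additive_set_plus:
  assumes "\<And>x y. f (x + y) = f x + f y"
  shows "f ` (S + T) = f ` S + f ` T"
proof -
  have "f ` (S + T) = {f (x + y) |x y. x \<in> S \<and> y \<in> T}"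
    unfolding set_plus_def by blast
  also have "\<dots> = f ` S + f ` T"
    unfolding set_plus_def assms by blast
  finally show ?thesis .
qed

text \<open>In terms of set sums, each operation of the quotient is the operation on all
  representatives followed by adding \<open>I\<close>. Comparing two quotients then becomes a
  calculation with set sums, without a choice of representatives.\<close>

lemma quot_alg_sel:
  fixes A :: "('a::plus) graded_alg"
  assumes "gadd A = (+)"
  shows "gcoset A I = (\<lambda>x. {x} + I)"
    "gcarrier (quot_alg A I) = (\<lambda>x. {x} + I) ` gcarrier A"
    "component (quot_alg A I) n = (\<lambda>x. {x} + I) ` component A n"
    "gadd (quot_alg A I) S T = S + T + I"
    "gscale (quot_alg A I) c S = gscale A c ` S + I"
    "gmult (quot_alg A I) S T = (\<Union>x\<in>S. \<Union>y\<in>T. {gmult A x y}) + I"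
proof -
  show *: "gcoset A I = (\<lambda>x. {x} + I)"
    by (rule ext) (simp add: gcoset_def assms singleton_image_set_plus)
  show "gcarrier (quot_alg A I) = (\<lambda>x. {x} + I) ` gcarrier A"
    "component (quot_alg A I) n = (\<lambda>x. {x} + I) ` component A n"
    by (simp_all add: quot_alg_def *)
  have "(\<Union>x\<in>S. \<Union>y\<in>T. {x + y}) = S + T" by (auto simp: set_plus_def)
  then show "gadd (quot_alg A I) S T = S + T + I"
    by (simp add: quot_alg_def * assms UN_set_plus)
  have "(\<Union>x\<in>S. {gscale A c x}) = gscale A c ` S" by auto
  then show "gscale (quot_alg A I) c S = gscale A c ` S + I"
    by (simp add: quot_alg_def * UN_set_plus)
  show "gmult (quot_alg A I) S T = (\<Union>x\<in>S. \<Union>y\<in>T. {gmult A x y}) + I"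
    by (simp add: quot_alg_def * UN_set_plus)
qed

lemma gadd_cochain_alg: "gadd (cochain_alg t V W n m) = (+)"
  by (simp add: cochain_alg_def fun_eq_iff)

lemma cohomology_alg_sel:
  fixes t :: "complex \<Rightarrow> 'v::ab_group_add \<Rightarrow> 'v" and D :: "('g list \<Rightarrow> 'v) \<Rightarrow> 'g list \<Rightarrow> 'v"
  defines "H \<equiv> \<lambda>V W n m. cohomology_alg (cochain_alg t V W n m) D"
  shows "gcarrier (H V W n m) = (\<lambda>x. {x} + D ` V) ` cocycles V D"
    "component (H V W n m) k = (\<lambda>x. {x} + D ` V) `
       ((if k < n then {0} else W (nat (k - n))) \<inter> cocycles V D)"
    "gadd (H V W n m) S T = S + T + D ` V"
    "gscale (H V W n m) c S = (\<lambda>f xs. t c (f xs)) ` S + D ` V"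
    "gmult (H V W n m) S T = (\<Union>x\<in>S. \<Union>y\<in>T. {m x y}) + D ` V"
proof -
  let ?A = "sub_alg (cochain_alg t V W n m) (cocycles V D)"
  have H: "H V W n m = quot_alg ?A (D ` V)"
    by (simp add: H_def cohomology_alg_def cochain_alg_def)
  have A: "gadd ?A = (+)" "gcarrier ?A = cocycles V D"
    "component ?A k = (if k < n then {0} else W (nat (k - n))) \<inter> cocycles V D"
    "gscale ?A = (\<lambda>c f xs. t c (f xs))" "gmult ?A = m"
    by (auto simp: sub_alg_def cochain_alg_def cocycles_def fun_eq_iff zero_fun_def)
  show "gcarrier (H V W n m) = (\<lambda>x. {x} + D ` V) ` cocycles V D"
    "component (H V W n m) k = (\<lambda>x. {x} + D ` V) `
       ((if k < n then {0} else W (nat (k - n))) \<inter> cocycles V D)"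
    "gadd (H V W n m) S T = S + T + D ` V"
    "gscale (H V W n m) c S = (\<lambda>f xs. t c (f xs)) ` S + D ` V"
    "gmult (H V W n m) S T = (\<Union>x\<in>S. \<Union>y\<in>T. {m x y}) + D ` V"
    unfolding H quot_alg_sel[OF A(1)] A(2-5) by (rule refl)+
qed

section \<open>Forms and cyclic cochains as alternating functions\<close>

context quadratic_lie_algebra
begin

section \<open>Linearity, nondegeneracy and representation of functionals\<close>

lemma linear_complex_iff:
  "Vector_Spaces.linear s (*) g \<longleftrightarrow> (\<forall>x y. g (x + y) = g x + g y) \<and> (\<forall>c x. g (s c x) = c * g x)"
proof -
  have "vector_space ((*) :: complex \<Rightarrow> _)"
    by unfold_locales (simp_all add: algebra_simps)
  then show ?thesis
    using vector_space_axioms unfolding Vector_Spaces.linear_iff by blast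
qed

lemma linear_self_iff:
  "Vector_Spaces.linear s s g \<longleftrightarrow> (\<forall>x y. g (x + y) = g x + g y) \<and> (\<forall>c x. g (s c x) = s c (g x))"
  using vector_space_axioms unfolding Vector_Spaces.linear_iff by blast

lemma B_add_left: "B (x + y) z = B x z + B y z"
  and B_add_right: "B z (x + y) = B z x + B z y"
  and B_scale_left: "B (s c x) z = c * B x z"
  and B_scale_right: "B z (s c x) = c * B z x"
  using B_linear_left B_linear_right unfolding linear_complex_iff by blast+

lemma B_zero_left [simp]: "B 0 z = 0" and B_zero_right [simp]: "B z 0 = 0"
  using B_add_left[of 0 0 z] B_add_right[of z 0 0] by simp_all

lemma B_minus_left: "B (- x) z = - B x z"
  using B_add_left[of x "- x" z] by (simp add: eq_neg_iff_add_eq_0 add.commute)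

lemma B_diff_left: "B (x - y) z = B x z - B y z"
  using B_add_left[of x "- y" z] by (simp add: B_minus_left)

lemma B_sum_left: "B (\<Sum>i\<in>I. f i) z = (\<Sum>i\<in>I. B (f i) z)"
  by (induction I rule: infinite_finite_induct) (simp_all add: B_add_left)

lemma B_eqI: "(\<And>z. B x z = B y z) \<Longrightarrow> x = y"
  using B_nondegenerate[of "x - y"] by (simp add: B_diff_left)

lemma br_add_left: "br (x + y) z = br x z + br y z"
  and br_add_right: "br z (x + y) = br z x + br z y"
  and br_scale_left: "br (s c x) z = s c (br x z)"
  and br_scale_right: "br z (s c x) = s c (br z x)"
  using br_linear_left br_linear_right unfolding linear_self_iff by blast+

lemma br_antisym: "br x y = - br y x"
  using br_alternating[of "x + y"] br_alternating[of x] br_alternating[of y]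
  by (simp add: br_add_left br_add_right eq_neg_iff_add_eq_0 add.commute)

text \<open>The values of \<open>B v\<close> on a basis are used as the coordinates of a vector in
  that same basis. This makes \<open>v\<close> to \<open>B v\<close> an endomorphism; it is
  injective by nondegeneracy, hence surjective in finite dimension.\<close>

lemma riesz_representation:
  assumes "\<And>x y. \<phi> (x + y) = \<phi> x + \<phi> y" "\<And>c x. \<phi> (s c x) = c * \<phi> x"
  obtains v where "\<And>z. B v z = \<phi> z"
proof -
  obtain S where "finite S" "span S = UNIV" using finite_dim by blast
  then obtain E where "E \<subseteq> S" and E: "independent E" "S \<subseteq> span E"
    using maximal_independent_subset[of S] by blast
  have "span S \<subseteq> span E" by (rule span_minimal[OF E(2)]) simp
  then have E': "finite E" "span E = UNIV"
    using finite_subset[OF \<open>E \<subseteq> S\<close> \<open>finite S\<close>] \<open>span S = UNIV\<close> by auto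
  interpret fd: finite_dimensional_vector_space s E
    by unfold_locales (use E E' in auto)
  interpret fp: finite_dimensional_vector_space_pair s E s E ..
  have eq_on_span: "B v z = \<psi> z" if "\<And>e. e \<in> E \<Longrightarrow> B v e = \<psi> e"
    "\<And>x y. \<psi> (x + y) = \<psi> x + \<psi> y" "\<And>c x. \<psi> (s c x) = c * \<psi> x" for v \<psi> z
  proof -
    have "z \<in> span E" using E' by simp
    then show ?thesis
    proof (induction rule: span_induct_alt)
      case base
      show ?case using that(3)[of 0 0] by simp
    next
      case (step c x y)
      then show ?case using that by (simp add: B_add_right B_scale_right)
    qed
  qed
  let ?T = "\<lambda>v. \<Sum>e\<in>E. s (B v e) e"
  have lin: "Vector_Spaces.linear s s ?T"
    unfolding linear_self_iff
    by (simp add: B_add_left B_scale_left scale_left_distrib sum.distrib scale_sum_right)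
  have coeff: "\<forall>e\<in>E. f e = g e" if "(\<Sum>e\<in>E. s (f e) e) = (\<Sum>e\<in>E. s (g e) e)" for f g
  proof -
    have "(\<Sum>e\<in>E. s (f e - g e) e) = 0"
      using that by (simp add: scale_left_diff_distrib sum_subtractf)
    then show ?thesis
      using independentD[OF E(1) E'(1) order_refl, of "\<lambda>e. f e - g e"] by simp
  qed
  have "inj ?T"
  proof (rule injI, rule B_eqI)
    fix x y z assume "?T x = ?T y"
    then have "\<forall>e\<in>E. B x e = B y e" by (rule coeff)
    then show "B x z = B y z"
      using eq_on_span[of x "B y" z] B_add_right[where z = y] B_scale_right[where z = y] by blast
  qed
  then have "surj ?T" by (rule fp.linear_injective_imp_surjective[OF lin _ refl])
  then obtain v where "?T v = (\<Sum>e\<in>E. s (\<phi> e) e)"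
    using surjD[of ?T "\<Sum>e\<in>E. s (\<phi> e) e"] by auto
  then have "\<forall>e\<in>E. B v e = \<phi> e" by (rule coeff)
  then have "B v z = \<phi> z" for z
    using eq_on_span[of v \<phi> z] assms by blast
  then show ?thesis by (rule that)
qed

section \<open>Skew symmetry and cyclicity as one alternation condition\<close>

lemma skew_maps_forms_iff:
  "f \<in> skew_maps s (*) k \<longleftrightarrow> alternating s f \<and> (\<forall>xs. length xs \<noteq> k \<longrightarrow> f xs = 0)"
proof (intro iffI conjI)
  assume f: "f \<in> skew_maps s (*) k"
  then show off: "\<forall>xs. length xs \<noteq> k \<longrightarrow> f xs = 0"
    by (simp add: skew_maps_def)
  have "\<forall>xs i. length xs = k \<longrightarrow> i < k \<longrightarrow> Vector_Spaces.linear s (*) (\<lambda>x. f (xs[i := x]))"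
    using f by (simp add: skew_maps_def)
  \<comment> \<open>The 0 in the instance \<open>us @ 0 # vs\<close> is a placeholder: the update
    overwrites it.\<close>
  then have lin: "Vector_Spaces.linear s (*) (\<lambda>x. f (us @ x # vs))"
    if "length us + Suc (length vs) = k" for us vs
    using that by (elim allE[of _ "us @ 0 # vs"] allE[of _ "length us"]) simp
  have "f (us @ (x + y) # vs) = f (us @ x # vs) + f (us @ y # vs)"
    "f (us @ s c x # vs) = c * f (us @ x # vs)" for us vs x y c
    using lin[of us vs] off unfolding linear_complex_iff
    by (cases "length us + Suc (length vs) = k"; simp)+
  moreover have "f (us @ x # y # vs) = - f (us @ y # x # vs)" for us vs x y
  proof (cases "length us + Suc (Suc (length vs)) = k")
    case True
    let ?t = "transpose (length us) (Suc (length us))"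
    have "f (permute_list ?t (us @ x # y # vs)) = of_int (sign ?t) * f (us @ x # y # vs)"
      using f True permutes_swap_id[of "length us" "{..<k}" "Suc (length us)"]
      unfolding skew_maps_def by auto
    then show ?thesis
      by (simp add: permute_list_transpose_Suc sign_swap_id)
  qed (use off in simp)
  ultimately show "alternating s f"
    by (intro alternatingI)
next
  assume f: "alternating s f \<and> (\<forall>xs. length xs \<noteq> k \<longrightarrow> f xs = 0)"
  have "Vector_Spaces.linear s (*) (\<lambda>x. f (xs[i := x]))" if "i < length xs" for xs i
  proof -
    have "alternating s f" using f by blast
    then show ?thesis
      using that by (simp add: linear_complex_iff upd_conv_take_nth_drop alternatingD(1,2))
  qed
  then show "f \<in> skew_maps s (*) k"
    using f alternating_permute[of s f] unfolding skew_maps_def by auto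
qed

lemma forms_iff: "f \<in> forms s k \<longleftrightarrow> alternating s f \<and> (\<forall>xs. length xs \<noteq> k \<longrightarrow> f xs = 0)"
  by (simp add: forms_def skew_maps_forms_iff)

lemma all_forms_iff:
  "f \<in> all_forms s \<longleftrightarrow> alternating s f \<and> (\<exists>N. \<forall>xs. N < length xs \<longrightarrow> f xs = 0)"
  unfolding all_forms_def skew_maps_sum_def skew_maps_forms_iff alternating_iff_arities[of s f]
  by (auto simp: arity_part_def)

lemma hat_snoc [simp]: "hat B C (xs @ [z]) = B (C xs) z"
  by (simp add: hat_def)

lemma hat_Nil [simp]: "hat B C [] = 0"
  by (simp add: hat_def)

lemma hat_inj: "hat B C = hat B C' \<Longrightarrow> C = C'"
proof
  fix xs assume "hat B C = hat B C'"
  then have "hat B C (xs @ [z]) = hat B C' (xs @ [z])" for z by simp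
  then show "C xs = C' xs" by (intro B_eqI) simp
qed

text \<open>Skew symmetry of \<open>C\<close> governs the exchanges that leave the last argument of
  \<open>hat B C\<close> alone. Cyclicity supplies the missing one, of the last two arguments, by
  rotating them to the front.\<close>

lemma alternating_hatI:
  assumes parts: "\<And>k. arity_part k C \<in> skew_maps s s k" and cyc: "cyclic B C"
  shows "alternating s (hat B C)"
proof -
  have lin: "Vector_Spaces.linear s s (\<lambda>x. C (us @ x # vs))" for us vs
  proof -
    let ?k = "length us + Suc (length vs)"
    have "\<forall>xs i. length xs = ?k \<longrightarrow> i < ?k \<longrightarrow>
        Vector_Spaces.linear s s (\<lambda>x. arity_part ?k C (xs[i := x]))"
      using parts[of ?k] by (simp add: skew_maps_def)
    then show ?thesis
      by (elim allE[of _ "us @ 0 # vs"] allE[of _ "length us"]) (simp add: arity_part_def)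
  qed
  have linear: "hat B C (us @ (x + y) # vs) = hat B C (us @ x # vs) + hat B C (us @ y # vs)
      \<and> hat B C (us @ s c x # vs) = c * hat B C (us @ x # vs)" for us vs x y c
  proof (cases vs rule: rev_cases)
    case Nil
    then show ?thesis by (simp add: B_add_right B_scale_right)
  next
    case (snoc ws z)
    have "hat B C (us @ w # vs) = B (C (us @ w # ws)) z" for w
      using hat_snoc[of C "us @ w # ws" z] snoc by simp
    then show ?thesis
      using lin[of us ws] by (simp add: linear_self_iff B_add_left B_scale_left)
  qed
  have swap: "hat B C (us @ x # y # vs) = - hat B C (us @ y # x # vs)" if ne: "vs \<noteq> []" for us vs x y
  proof -
    obtain ws z where vs: "vs = ws @ [z]" using ne by (cases vs rule: rev_cases) auto
    let ?k = "length us + Suc (Suc (length ws))" and ?t = "transpose (length us) (Suc (length us))"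
    have "arity_part ?k C (permute_list ?t (us @ y # x # ws))
        = s (of_int (sign ?t)) (arity_part ?k C (us @ y # x # ws))"
      using parts[of ?k] permutes_swap_id[of "length us" "{..<?k}" "Suc (length us)"]
      unfolding skew_maps_def by auto
    then have "C (us @ x # y # ws) = s (-1) (C (us @ y # x # ws))"
      by (simp add: permute_list_transpose_Suc sign_swap_id arity_part_def)
    then show ?thesis
      using hat_snoc[of C "us @ x # y # ws" z] hat_snoc[of C "us @ y # x # ws" z] vs
      by (simp add: B_minus_left)
  qed
  have rot: "hat B C (us @ [z]) = (-1) ^ length us * hat B C (z # us)" for us z
    using cyc[unfolded cyclic_def, rule_format, of "us @ [z]" "length us"] by simp
  have antisym: "hat B C (us @ x # y # vs) = - hat B C (us @ y # x # vs)" for us vs x y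
  proof (cases "vs = []")
    case False
    then show ?thesis by (rule swap)
  next
    case True
    \<comment> \<open>Each of the two rotations has the sign \<open>(-1) ^ (length us + 1)\<close>,
      so the signs cancel.\<close>
    have rot2: "hat B C (us @ [x, y]) = hat B C (x # y # us)" for x y
    proof -
      have "hat B C (us @ [x, y]) = (-1) ^ (length us + 1) * hat B C (y # us @ [x])"
        using rot[of "us @ [x]" y] by simp
      also have "\<dots> = hat B C (x # y # us)"
        using rot[of "y # us" x] by simp
      finally show ?thesis .
    qed
    \<comment> \<open>For empty \<open>us\<close> nothing follows the pair after the rotation, but
      then cyclicity in arity 1 is itself the exchange.\<close>
    show ?thesis
    proof (cases "us = []")
      case us: True
      show ?thesis using rot[of "[x]" y] by (simp add: us True)
    next
      case False
      then show ?thesis using swap[where us = "[]" and vs = us, of x y] by (simp add: True rot2)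
    qed
  qed
  show ?thesis
    by (rule alternatingI)
      (rule linear[THEN conjunct1] linear[THEN conjunct2] antisym)+
qed

text \<open>A test vector appended to the list is fixed by the permutation, so the symmetry of
  \<open>hat B C\<close> restricts to that of \<open>C\<close>.\<close>

lemma hat_permute:
  assumes "alternating s (hat B C)" "\<sigma> permutes {..<length xs}"
  shows "C (permute_list \<sigma> xs) = s (of_int (sign \<sigma>)) (C xs)"
proof (rule B_eqI)
  fix z
  have "\<sigma> permutes {..<length (xs @ [z])}"
    by (rule permutes_subset[OF assms(2)]) auto
  from alternating_permute[OF assms(1) this]
  show "B (C (permute_list \<sigma> xs)) z = B (s (of_int (sign \<sigma>)) (C xs)) z"
    by (simp add: permute_list_snoc[OF assms(2)] B_scale_left)
qed

text \<open>Pairing with a last argument detects the linearity and skew symmetry of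
  \<open>C\<close>; cyclicity is the case of a rotation of \<open>k + 1\<close> arguments, whose
  sign is \<open>(-1) ^ k\<close>.\<close>

lemma alternating_hatD:
  assumes alt: "alternating s (hat B C)"
  shows "arity_part k C \<in> skew_maps s s k" "cyclic B C"
proof -
  have "C (us @ (x + y) # vs) = C (us @ x # vs) + C (us @ y # vs)"
    "C (us @ s c x # vs) = s c (C (us @ x # vs))" for us vs x y c
    using alternatingD(1,2)[OF alt, of us _ _ "vs @ [_]"] hat_snoc[of C "us @ _ # vs"]
    by (auto intro!: B_eqI simp: B_add_left B_scale_left)
  then have "Vector_Spaces.linear s s (\<lambda>x. C (xs[i := x]))" if "i < length xs" for xs i
    using that unfolding linear_self_iff by (simp add: upd_conv_take_nth_drop)
  then show "arity_part k C \<in> skew_maps s s k"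
    using hat_permute[OF alt] by (auto simp: skew_maps_def arity_part_def)
  show "cyclic B C"
    unfolding cyclic_def
  proof (intro allI impI)
    fix k and ys :: "'g list" assume k: "length ys = k + 1"
    then obtain us z where "ys = us @ [z]" by (cases ys rule: rev_cases) auto
    then show "hat B C ys = (- 1) ^ k * hat B C (last ys # butlast ys)"
      using k alternating_rotate[OF alt, of us z "[]"] by simp
  qed
qed

lemma all_cyclic_cochains_iff:
  "C \<in> all_cyclic_cochains s B \<longleftrightarrow>
     alternating s (hat B C) \<and> (\<exists>N. \<forall>xs. N < length xs \<longrightarrow> C xs = 0)"
  using alternating_hatI[of C] alternating_hatD[of C]
  unfolding all_cyclic_cochains_def skew_maps_sum_def by auto

lemma cyclic_cochains_iff:
  "C \<in> cyclic_cochains s B k \<longleftrightarrow>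
     alternating s (hat B C) \<and> (\<forall>xs. length xs \<noteq> k \<longrightarrow> C xs = 0)"
proof (intro iffI conjI)
  assume C: "C \<in> cyclic_cochains s B k"
  then show off: "\<forall>xs. length xs \<noteq> k \<longrightarrow> C xs = 0"
    by (simp add: cyclic_cochains_def skew_maps_def)
  have zero: "(\<lambda>xs. 0) \<in> skew_maps s s j" for j
    by (simp add: skew_maps_def linear_self_iff)
  have "arity_part j C = (if j = k then C else (\<lambda>xs. 0))" for j
    using off by (auto simp: arity_part_def fun_eq_iff)
  then have "arity_part j C \<in> skew_maps s s j" for j
    using C zero by (auto simp: cyclic_cochains_def)
  then show "alternating s (hat B C)"
    using C by (intro alternating_hatI) (auto simp: cyclic_cochains_def)
next
  assume C: "alternating s (hat B C) \<and> (\<forall>xs. length xs \<noteq> k \<longrightarrow> C xs = 0)"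
  then have "arity_part k C = C" by (auto simp: arity_part_def fun_eq_iff)
  then show "C \<in> cyclic_cochains s B k"
    using alternating_hatD(1)[of C k] alternating_hatD(2)[of C] C by (simp add: cyclic_cochains_def)
qed

section \<open>The bijection \<open>\<Phi>\<close>\<close>

lemma alternating_Phi_iff: "alternating s (Phi B C) \<longleftrightarrow> alternating s (hat B C)"
proof
  assume "alternating s (Phi B C)"
  then have "alternating s (\<lambda>xs. - 2 * Phi B C xs)" by (rule alternating_scale)
  then show "alternating s (hat B C)" by (simp add: Phi_def)
next
  assume "alternating s (hat B C)"
  then show "alternating s (Phi B C)" unfolding Phi_def by (rule alternating_scale)
qed

lemma Phi_snoc [simp]: "Phi B C (xs @ [z]) = - (1 / 2) * B (C xs) z"
  by (simp add: Phi_def)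

lemma Phi_Nil [simp]: "Phi B C [] = 0"
  by (simp add: Phi_def)

lemma inj_Phi: "inj (Phi B)"
  by (rule injI, rule hat_inj) (auto simp: Phi_def fun_eq_iff)

lemma Phi_add: "Phi B (C + C') = Phi B C + Phi B C'"
  by (auto simp: Phi_def fun_eq_iff hat_def B_add_left algebra_simps)

lemma Phi_scale: "Phi B (\<lambda>xs. s c (C xs)) = (\<lambda>xs. c * Phi B C xs)"
  by (auto simp: Phi_def fun_eq_iff hat_def B_scale_left)

lemma Phi_zero: "Phi B 0 = 0"
  by (auto simp: Phi_def fun_eq_iff hat_def)

lemma eq_zero_iff_Phi: "C xs = 0 \<longleftrightarrow> (\<forall>z. Phi B C (xs @ [z]) = 0)"
  using B_nondegenerate[of "C xs"] by auto

lemma Phi_surj: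
  assumes "alternating s \<Omega>" "\<Omega> [] = 0"
  obtains C where "Phi B C = \<Omega>"
proof -
  \<comment> \<open>For fixed \<open>xs\<close> the last slot of \<Omega> is a linear functional,
    and -2 inverts the factor of \<Phi>. The vectors are chosen list by list; linearity and symmetry
    of \<open>C\<close> can be read off afterwards from \<open>Phi B C = \<Omega>\<close>.\<close>
  have "\<exists>v. \<forall>z. B v z = -2 * \<Omega> (xs @ [z])" for xs
  proof -
    show ?thesis
      by (rule riesz_representation[of "\<lambda>z. -2 * \<Omega> (xs @ [z])"])
        (simp add: alternatingD(1)[OF assms(1)], simp add: alternatingD(2)[OF assms(1)], blast)
  qed
  then obtain C where C: "\<And>xs z. B (C xs) z = -2 * \<Omega> (xs @ [z])" by metis
  have "Phi B C = \<Omega>"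
  proof
    fix xs show "Phi B C xs = \<Omega> xs"
      by (cases xs rule: rev_cases) (simp_all add: C assms)
  qed
  then show ?thesis by (rule that)
qed

lemma positive_forms_iff:
  "\<Omega> \<in> positive_forms s \<longleftrightarrow>
     alternating s \<Omega> \<and> (\<exists>N. \<forall>xs. N < length xs \<longrightarrow> \<Omega> xs = 0) \<and> \<Omega> [] = 0"
  by (auto simp: positive_forms_def all_forms_iff)

lemma Phi_mem_positive_forms: "Phi B C \<in> positive_forms s \<longleftrightarrow> C \<in> all_cyclic_cochains s B"
proof
  assume "C \<in> all_cyclic_cochains s B"
  then obtain N where alt: "alternating s (hat B C)" and N: "\<forall>xs. N < length xs \<longrightarrow> C xs = 0"
    unfolding all_cyclic_cochains_iff by blast
  have "Phi B C xs = 0" if "Suc N < length xs" for xs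
    using that N by (cases xs rule: rev_cases) auto
  then show "Phi B C \<in> positive_forms s"
    unfolding positive_forms_iff alternating_Phi_iff using alt by auto
next
  assume "Phi B C \<in> positive_forms s"
  then obtain N where alt: "alternating s (hat B C)" and N: "\<forall>xs. N < length xs \<longrightarrow> Phi B C xs = 0"
    unfolding positive_forms_iff alternating_Phi_iff by blast
  have "C xs = 0" if "N < length xs" for xs
    unfolding eq_zero_iff_Phi using that N by (metis length_append_singleton less_SucI)
  then show "C \<in> all_cyclic_cochains s B"
    unfolding all_cyclic_cochains_iff using alt by blast
qed

lemma Phi_mem_forms: "Phi B C \<in> forms s (Suc k) \<longleftrightarrow> C \<in> cyclic_cochains s B k"
proof
  assume C: "C \<in> cyclic_cochains s B k"
  have "Phi B C xs = 0" if "length xs \<noteq> Suc k" for xs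
    using that C unfolding cyclic_cochains_iff by (cases xs rule: rev_cases) auto
  then show "Phi B C \<in> forms s (Suc k)"
    using C unfolding forms_iff cyclic_cochains_iff alternating_Phi_iff by blast
next
  assume C: "Phi B C \<in> forms s (Suc k)"
  have "C xs = 0" if "length xs \<noteq> k" for xs
    unfolding eq_zero_iff_Phi
  proof
    fix z
    have "length (xs @ [z]) \<noteq> Suc k" using that by simp
    then show "Phi B C (xs @ [z]) = 0" using C unfolding forms_iff by blast
  qed
  then show "C \<in> cyclic_cochains s B k"
    using C unfolding forms_iff cyclic_cochains_iff alternating_Phi_iff by blast
qed

lemma Phi_image_cochains: "Phi B ` all_cyclic_cochains s B = positive_forms s"
proof (intro equalityI subsetI)
  fix \<Omega> assume \<Omega>: "\<Omega> \<in> positive_forms s"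
  then obtain C where "Phi B C = \<Omega>"
    using Phi_surj unfolding positive_forms_iff by blast
  then show "\<Omega> \<in> Phi B ` all_cyclic_cochains s B"
    using \<Omega> Phi_mem_positive_forms by blast
qed (auto simp: Phi_mem_positive_forms)

lemma Phi_image_arity: "Phi B ` cyclic_cochains s B k = forms s (Suc k)"
proof (intro equalityI subsetI)
  fix \<Omega> assume \<Omega>: "\<Omega> \<in> forms s (Suc k)"
  then obtain C where "Phi B C = \<Omega>"
    using Phi_surj[of \<Omega>] unfolding forms_iff by auto
  then show "\<Omega> \<in> Phi B ` cyclic_cochains s B k"
    using \<Omega> Phi_mem_forms by blast
qed (auto simp: Phi_mem_forms)

section \<open>Products and differentials\<close>

text \<open>The product on cyclic cochains is an \<open>inv_into\<close>, which inverts \<Phi> only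
  on its image; this places the wedge product in that image.\<close>

lemma wedge_positive:
  assumes "\<Omega> \<in> positive_forms s" "\<Omega>' \<in> positive_forms s"
  shows "wedge \<Omega> \<Omega>' \<in> positive_forms s"
proof -
  obtain N where alt: "alternating s \<Omega>" "\<Omega> [] = 0" and N: "\<forall>xs. N < length xs \<longrightarrow> \<Omega> xs = 0"
    using assms(1) unfolding positive_forms_iff by blast
  obtain N' where alt': "alternating s \<Omega>'" and N': "\<forall>xs. N' < length xs \<longrightarrow> \<Omega>' xs = 0"
    using assms(2) unfolding positive_forms_iff by blast
  have eq: "wedge \<Omega> \<Omega>' = split_sum (\<lambda>A D. \<Omega> A * \<Omega>' D)"
    by (rule HOL.ext) (rule wedge_split_sum)
  have "alternating s (wedge \<Omega> \<Omega>')"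
    unfolding eq using alt(1) alt'
    by (intro alternating_split_sum)
      (metis (no_types, lifting) ext alternating_scale mult.commute)+
  moreover have "wedge \<Omega> \<Omega>' xs = 0" if "N + N' < length xs" for xs
  proof -
    have "wedge \<Omega> \<Omega>' xs = split_sum (\<lambda>A D. 0) xs"
      unfolding eq
    proof (rule split_sum_cong)
      fix A D :: "'g list" assume "length A + length D = length xs"
      then have "N < length A \<or> N' < length D" using that by linarith
      then show "\<Omega> A * \<Omega>' D = 0" using N N' by auto
    qed
    then show ?thesis by simp
  qed
  ultimately show ?thesis
    unfolding positive_forms_iff using alt(2) by (auto simp: eq)
qed

lemma chevalley_diff_short: "length xs \<le> 1 \<Longrightarrow> chevalley_diff br \<Omega> xs = 0"
  by (cases xs) (simp_all add: chevalley_diff_def)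

lemma chevalley_diff_positive:
  assumes "\<Omega> \<in> all_forms s"
  shows "chevalley_diff br \<Omega> \<in> positive_forms s"
proof -
  obtain N where alt: "alternating s \<Omega>" and N: "\<forall>xs. N < length xs \<longrightarrow> \<Omega> xs = 0"
    using assms unfolding all_forms_iff by blast
  let ?h = "\<lambda>A D. if length A = 2 then \<Omega> (br (A ! 0) (A ! 1) # D) else 0"
  have eq: "chevalley_diff br \<Omega> = (\<lambda>xs. - split_sum ?h xs)"
    by (rule HOL.ext) (rule chevalley_diff_split_sum)
  have "alternating s (?h A)" for A
    by (cases "length A = 2") (simp_all add: alternating_zero alternating_Cons[OF alt])
  moreover have "alternating s (\<lambda>A. ?h A D)" for D
  proof (rule alternatingI)
    fix us vs :: "'g list" and x y c
    \<comment> \<open>Only lists of length 2 enter the bracket: the varied argument is the first or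
      the second entry, and for other lengths both sides vanish.\<close>
    consider "us = []" "length vs = 1" | "length us = 1" "vs = []" | "length us + length vs \<noteq> 1"
      by (cases us; cases vs) auto
    note cs = this
    show "?h (us @ (x + y) # vs) D = ?h (us @ x # vs) D + ?h (us @ y # vs) D"
      using cs by cases (auto simp: length_Suc_conv br_add_left br_add_right alternating_Nil_D(1)[OF alt])
    show "?h (us @ s c x # vs) D = c * ?h (us @ x # vs) D"
      using cs by cases (auto simp: length_Suc_conv br_scale_left br_scale_right alternating_Nil_D(2)[OF alt])
    have neg: "\<Omega> (- u # D) = - \<Omega> (u # D)" for u
      using alternating_Nil_D(2)[OF alt, of "-1" u D] by simp
    show "?h (us @ x # y # vs) D = - ?h (us @ y # x # vs) D"
      by (cases "us = [] \<and> vs = []") (auto simp: br_antisym[of x y] neg)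
  qed
  ultimately have "alternating s (chevalley_diff br \<Omega>)"
    unfolding eq alternating_minus by (intro alternating_split_sum)
  \<comment> \<open>The bracket merges two arguments into one, so the bound on the arity grows by
    one.\<close>
  moreover have "chevalley_diff br \<Omega> xs = 0" if "Suc N < length xs" for xs
  proof -
    have "split_sum ?h xs = split_sum (\<lambda>A D. 0) xs"
      by (rule split_sum_cong) (use that N in auto)
    then show ?thesis by (simp add: eq)
  qed
  ultimately show ?thesis
    unfolding positive_forms_iff using chevalley_diff_short[of "[]" \<Omega>] by auto
qed

lemma chevalley_diff_add: "chevalley_diff br (\<Omega> + \<Omega>') = chevalley_diff br \<Omega> + chevalley_diff br \<Omega>'"
  by (auto simp: chevalley_diff_def fun_eq_iff sum.distrib distrib_left)

lemma chevalley_diff_scale: "chevalley_diff br (\<lambda>xs. c * \<Omega> xs) = (\<lambda>xs. c * chevalley_diff br \<Omega> xs)"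
  by (auto simp: chevalley_diff_def fun_eq_iff sum_distrib_left mult.left_commute)

lemma chevalley_diff_zero: "chevalley_diff br 0 = 0"
  by (auto simp: chevalley_diff_def fun_eq_iff)

lemma chevalley_diff_const:
  assumes "\<And>xs. xs \<noteq> [] \<Longrightarrow> \<Omega> xs = 0"
  shows "chevalley_diff br \<Omega> = 0"
  by (auto simp: chevalley_diff_def fun_eq_iff assms)

section \<open>The Gerstenhaber bracket paired with a test vector\<close>

lemma B_insertion_sum:
  assumes "length xs = a + b"
  shows "B (insertion_sum s (Suc a) b F G xs) z
    = split_sum (\<lambda>A D. if length A = b then B (F (G A # D)) z else 0) xs"
  using sum_unshuffles[of xs b a "\<lambda>A D. B (F (G A # D)) z"] assms
  by (simp add: insertion_sum_def B_sum_left B_scale_left add.commute)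

lemma insertion_sum_0 [simp]: "insertion_sum s 0 b F G xs = 0"
  by (simp add: insertion_sum_def)

text \<open>In the first half \<open>length A = b\<close> and \<open>length D = a - 1\<close>, so
  \<open>(a + 1) * (b + 1)\<close> has the parity of
  \<open>length D * (length A + 1)\<close>.\<close>

lemma B_gerstenhaber:
  "B (gerstenhaber s F G xs) z
    = split_sum (\<lambda>A D. (-1) ^ (length D * (length A + 1)) * B (F (G A # D)) z) xs
      - split_sum (\<lambda>A D. B (G (F A # D)) z) xs"
proof -
  define n where "n = length xs"
  have "(\<Sum>a\<le>n + 1. (-1) ^ ((a + 1) * (n + 1 - a + 1)) * B (insertion_sum s a (n + 1 - a) F G xs) z)
      = (\<Sum>b\<le>n + 1. (-1) ^ ((n + 1 - b + 1) * (b + 1)) * B (insertion_sum s (n + 1 - b) b F G xs) z)"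
    by (rule sum.reindex_bij_witness[of _ "\<lambda>a. n + 1 - a" "\<lambda>a. n + 1 - a"]) auto
  \<comment> \<open>The term \<open>b = n + 1\<close> has \<open>a = 0\<close>: such a map offers no
    slot for an insertion, and the term vanishes.\<close>
  also have "\<dots> = (\<Sum>b\<le>n. (-1) ^ ((n + 1 - b + 1) * (b + 1)) * B (insertion_sum s (Suc (n - b)) b F G xs) z)"
    by (auto simp: Suc_diff_le intro!: sum.cong)
  also have "\<dots> = (\<Sum>b\<le>n. split_sum (\<lambda>A D. if length A = b
      then (-1) ^ ((n + 1 - b + 1) * (b + 1)) * B (F (G A # D)) z else 0) xs)"
    by (intro sum.cong refl)
      (simp add: B_insertion_sum n_def split_sum_scale[symmetric] if_distrib[of "\<lambda>x. _ * x"] cong: if_cong)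
  also have "\<dots> = split_sum (\<lambda>A D. (-1) ^ ((n + 1 - length A + 1) * (length A + 1)) * B (F (G A # D)) z) xs"
    unfolding n_def
    by (rule split_sum_by_length[where
          h = "\<lambda>b A D. (-1) ^ ((length xs + 1 - b + 1) * (b + 1)) * B (F (G A # D)) z"])
  also have "\<dots> = split_sum (\<lambda>A D. (-1) ^ (length D * (length A + 1)) * B (F (G A # D)) z) xs"
  proof (rule split_sum_cong)
    fix A D :: "'g list" assume "length A + length D = length xs"
    then have e: "n + 1 - length A + 1 = length D + 2" by (simp add: n_def)
    show "(-1) ^ ((n + 1 - length A + 1) * (length A + 1)) * B (F (G A # D)) z
        = (-1) ^ (length D * (length A + 1)) * B (F (G A # D)) z"
      unfolding e distrib_right[of "length D"] power_add by simp
  qed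
  finally have 1: "(\<Sum>a\<le>n + 1. (-1) ^ ((a + 1) * (n + 1 - a + 1)) * B (insertion_sum s a (n + 1 - a) F G xs) z)
      = split_sum (\<lambda>A D. (-1) ^ (length D * (length A + 1)) * B (F (G A # D)) z) xs" .
  have "(\<Sum>a\<le>n + 1. B (insertion_sum s (n + 1 - a) a G F xs) z)
      = (\<Sum>a\<le>n. B (insertion_sum s (Suc (n - a)) a G F xs) z)"
    by (auto simp: Suc_diff_le intro!: sum.cong)
  also have "\<dots> = (\<Sum>a\<le>n. split_sum (\<lambda>A D. if length A = a then B (G (F A # D)) z else 0) xs)"
    by (intro sum.cong refl) (simp add: B_insertion_sum n_def)
  also have "\<dots> = split_sum (\<lambda>A D. B (G (F A # D)) z) xs"
    unfolding n_def by (rule split_sum_by_length)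
  finally have 2: "(\<Sum>a\<le>n + 1. B (insertion_sum s (n + 1 - a) a G F xs) z)
      = split_sum (\<lambda>A D. B (G (F A # D)) z) xs" .
  show ?thesis
    unfolding 1[symmetric] 2[symmetric]
    by (simp add: gerstenhaber_def Let_def B_sum_left B_diff_left B_scale_left sum_subtractf n_def
        del: sum.atMost_Suc)
qed

text \<open>Rotation brings the first argument \<open>u\<close> of \<open>C\<close> into the second
  slot of \<open>B\<close>. If \<open>u\<close> is itself a value of a cochain, a nested expression
  becomes a pairing of two values.\<close>

lemma B_cyclic_rotate:
  assumes "alternating s (hat B C)"
  shows "B (C (u # D)) z = - ((-1) ^ length D) * B (C (D @ [z])) u"
    "B (C D) u = (-1) ^ length D * hat B C (u # D)"
proof -
  have "B (C (D @ [z])) u = (-1) ^ (length D + 1) * hat B C ((u # D) @ [z])"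
    using alternating_rotate[OF assms, of "D @ [z]" u "[]"] hat_snoc[of C "D @ [z]" u] by simp
  then show "B (C (u # D)) z = - ((-1) ^ length D) * B (C (D @ [z])) u"
    unfolding hat_snoc by (simp flip: mult.assoc)
  show "B (C D) u = (-1) ^ length D * hat B C (u # D)"
    using alternating_rotate[OF assms, of D u "[]"] hat_snoc[of C D u] by simp
qed

lemma B_gerstenhaber_cyclic:
  assumes "C \<in> all_cyclic_cochains s B" "C' \<in> all_cyclic_cochains s B"
  shows "B (gerstenhaber s C C' xs) z
    = - split_sum (\<lambda>A D. (-1) ^ length D * B (C A) (C' D)) (xs @ [z])"
proof -
  have alt: "alternating s (hat B C)" "alternating s (hat B C')"
    using assms by (simp_all add: all_cyclic_cochains_iff)
  \<comment> \<open>The value \<open>C' A\<close> is rotated out and \<open>z\<close> joins the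
    arguments of \<open>C\<close>. What remains of the sign is minus the sign of a block exchange,
    and the exchange puts the arguments of \<open>C\<close> on the left.\<close>
  have "split_sum (\<lambda>A D. (-1) ^ (length D * (length A + 1)) * B (C (C' A # D)) z) xs
      = split_sum (\<lambda>A D. (-1) ^ (length A * length D) * - B (C (D @ [z])) (C' A)) xs"
    by (rule split_sum_cong)
      (simp add: B_cyclic_rotate(1)[OF alt(1), of "C' _"] minus_one_power_iff)
  also have "\<dots> = - split_sum (\<lambda>A D. B (C (A @ [z])) (C' D)) xs"
    unfolding split_sum_swap[of "\<lambda>A D. - B (C (D @ [z])) (C' A)", symmetric]
    by (rule split_sum_minus)
  finally have 1: "split_sum (\<lambda>A D. (-1) ^ (length D * (length A + 1)) * B (C (C' A # D)) z) xs
      = - split_sum (\<lambda>A D. B (C (A @ [z])) (C' D)) xs" .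
  \<comment> \<open>In this half \<open>z\<close> joins the arguments of \<open>C'\<close>, and the
    blocks are already in order.\<close>
  have 2: "split_sum (\<lambda>A D. B (C' (C A # D)) z) xs
      = - split_sum (\<lambda>A D. (-1) ^ length D * B (C A) (C' (D @ [z]))) xs"
    unfolding split_sum_minus[symmetric]
    by (rule split_sum_cong)
      (simp add: B_cyclic_rotate(1)[OF alt(2), of "C _"] B_symmetric[of "C _"])
  have 3: "split_sum (\<lambda>A D. (-1) ^ length D * B (C A) (C' D)) (xs @ [z])
      = split_sum (\<lambda>A D. B (C (A @ [z])) (C' D)) xs
        - split_sum (\<lambda>A D. (-1) ^ length D * B (C A) (C' (D @ [z]))) xs"
    unfolding split_sum_snoc by (simp add: split_sum_minus flip: mult.assoc)
  show ?thesis unfolding B_gerstenhaber 1 2 3 by simp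
qed

section \<open>The super Poisson bracket and the differential under \<Phi>\<close>

lemma super_poisson_Phi:
  assumes E: "orthonormal_basis s B E"
    and C: "C \<in> all_cyclic_cochains s B" "C' \<in> all_cyclic_cochains s B"
  shows "super_poisson E (Phi B C) (Phi B C') xs
    = 1 / 2 * split_sum (\<lambda>A D. (-1) ^ length D * B (C A) (C' D)) xs"
proof -
  have alt: "alternating s (hat B C)" "alternating s (hat B C')"
    using C by (simp_all add: all_cyclic_cochains_iff)
  have orth: "B x y = (if x = y then 1 else 0)" if "x \<in> E" "y \<in> E" for x y
    using E that by (auto simp: orthonormal_basis_def)
  have E_fin: "finite E" "span E = UNIV" using E by (auto simp: orthonormal_basis_def)
  have parseval: "(\<Sum>X\<in>E. B u X * B v X) = B u v" for u v
  proof -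
    have "u \<in> span E" using E_fin by simp
    then show ?thesis
    proof (induction rule: span_induct_alt)
      case base
      show ?case by simp
    next
      case (step c x y)
      have "(\<Sum>X\<in>E. B x X * B v X) = (\<Sum>X\<in>E. if X = x then B v X else 0)"
        by (rule sum.cong) (auto simp: orth step)
      also have "\<dots> = B x v" using E_fin step by (simp add: B_symmetric)
      finally show ?case
        using step by (simp add: B_add_left B_scale_left distrib_right sum.distrib mult.assoc
            flip: sum_distrib_left)
    qed
  qed
  have Phi: "Phi B C (X # A) = - (1 / 2) * ((-1) ^ length A * B (C A) X)"
    "Phi B C' (X # A) = - (1 / 2) * ((-1) ^ length A * B (C' A) X)" for X A
    using B_cyclic_rotate(2)[OF alt(1), of A X] B_cyclic_rotate(2)[OF alt(2), of A X]
    by (simp_all add: Phi_def flip: mult.assoc)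
  have "super_poisson E (Phi B C) (Phi B C') xs
      = 2 * split_sum (\<lambda>A D. \<Sum>X\<in>E. (-1) ^ length A * Phi B C (X # A) * Phi B C' (X # D)) xs"
    by (simp add: super_poisson_def wedge_split_sum inner_der_def split_sum_sum)
  also have "\<dots> = 2 * split_sum (\<lambda>A D. 1 / 4 * ((-1) ^ length D * B (C A) (C' D))) xs"
  proof -
    \<comment> \<open>The sign of the bracket cancels the one from rotating \<open>X\<close> behind
      \<open>A\<close>, leaving the one from rotating it behind \<open>D\<close>; the two factors
      -1/2 give 1/4.\<close>
    have "(\<Sum>X\<in>E. (-1) ^ length A * Phi B C (X # A) * Phi B C' (X # D))
        = 1 / 4 * ((-1) ^ length D * B (C A) (C' D))" for A D
    proof -
      have "(\<Sum>X\<in>E. (-1) ^ length A * Phi B C (X # A) * Phi B C' (X # D))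
          = (\<Sum>X\<in>E. 1 / 4 * ((-1) ^ length D * (B (C A) X * B (C' D) X)))"
        by (rule sum.cong) (simp_all add: Phi minus_one_power_iff)
      then show ?thesis by (simp only: parseval flip: sum_distrib_left)
    qed
    then show ?thesis by (simp only:)
  qed
  finally show ?thesis unfolding split_sum_scale by simp
qed

text \<open>A nonempty list has a last entry, and this entry serves as the test vector of
  \<open>B_gerstenhaber_cyclic\<close>.\<close>

lemma Phi_gerstenhaber:
  assumes "orthonormal_basis s B E"
    and "C \<in> all_cyclic_cochains s B" "C' \<in> all_cyclic_cochains s B" "xs \<noteq> []"
  shows "super_poisson E (Phi B C) (Phi B C') xs = Phi B (gerstenhaber s C C') xs"
  using assms(4) super_poisson_Phi[OF assms(1-3)] B_gerstenhaber_cyclic[OF assms(2,3)]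
  by (cases xs rule: rev_cases) simp_all

text \<open>The pairs bracketed by \<partial> either contain the last argument \<open>z\<close> or
  avoid it. Bracketing a value of \<open>C\<close> accounts for the former, through invariance of
  \<open>B\<close> and cyclicity; inserting a bracket into \<open>C\<close> accounts for the
  latter.\<close>

lemma Phi_adjoint_diff:
  assumes "C \<in> all_cyclic_cochains s B"
  shows "Phi B (adjoint_diff s br C) = chevalley_diff br (Phi B C)"
proof
  fix ys
  have alt: "alternating s (hat B C)"
    using assms by (simp add: all_cyclic_cochains_iff)
  show "Phi B (adjoint_diff s br C) ys = chevalley_diff br (Phi B C) ys"
  proof (cases ys rule: rev_cases)
    case Nil
    then show ?thesis by (simp add: chevalley_diff_short)
  next
    case (snoc xs z)
    let ?F = "bracket_cochain br"
    let ?\<Omega> = "hat B C"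
    let ?h = "\<lambda>A D. if length A = 2 then ?\<Omega> (br (A ! 0) (A ! 1) # D) else 0"
    \<comment> \<open>The bracket cochain leaves only \<open>length D = 1\<close>; antisymmetry then
      turns the sign into that of a block exchange.\<close>
    have "split_sum (\<lambda>A D. (-1) ^ (length D * (length A + 1)) * B (?F (C A # D)) z) xs
        = split_sum (\<lambda>A D. (-1) ^ (length A * length D) *
            (if length D = 1 then B (br (D ! 0) (C A)) z else 0)) xs"
    proof (rule split_sum_cong)
      fix A D
      show "(-1) ^ (length D * (length A + 1)) * B (?F (C A # D)) z
          = (-1) ^ (length A * length D) * (if length D = 1 then B (br (D ! 0) (C A)) z else 0)"
        using br_antisym[of "C A" "D ! 0"]
        by (auto simp: bracket_cochain_def B_minus_left)
    qed
    also have "\<dots> = split_sum (\<lambda>A D. if length A = 1 then B (br (A ! 0) (C D)) z else 0) xs"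
      by (rule split_sum_swap[symmetric])
    also have "\<dots> = - split_sum (\<lambda>A D. (-1) ^ length D * ?h (A @ [z]) D) xs"
      unfolding split_sum_minus[symmetric]
    proof (rule split_sum_cong)
      fix A D
      \<comment> \<open>Invariance moves the bracket onto \<open>z\<close>, and a rotation brings
        \<open>br a z\<close> to the front.\<close>
      have "B (br a (C D)) z = - ((-1) ^ length D * ?\<Omega> (br a z # D))" for a
        using B_cyclic_rotate(2)[OF alt, of D "br a z"] br_antisym[of a "C D"]
        by (simp add: B_minus_left B_invariant)
      then show "(if length A = 1 then B (br (A ! 0) (C D)) z else 0)
          = - ((-1) ^ length D * ?h (A @ [z]) D)"
        by (auto simp: length_Suc_conv)
    qed
    finally have 1: "split_sum (\<lambda>A D. (-1) ^ (length D * (length A + 1)) * B (?F (C A # D)) z) xs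
        = - split_sum (\<lambda>A D. (-1) ^ length D * ?h (A @ [z]) D) xs" .
    have 2: "split_sum (\<lambda>A D. B (C (?F A # D)) z) xs = split_sum (\<lambda>A D. ?h A (D @ [z])) xs"
    proof (rule split_sum_cong)
      fix A D
      \<comment> \<open>If \<open>length A\<close> is not 2, the inserted vector is 0 and linearity
        makes the left side vanish.\<close>
      show "B (C (?F A # D)) z = ?h A (D @ [z])"
        using hat_snoc[of C "?F A # D" z] alternating_Nil_D(2)[OF alt, of 0 0 "D @ [z]"]
        by (cases "length A = 2") (simp_all add: bracket_cochain_def)
    qed
    have 3: "chevalley_diff br (Phi B C) ys = 1 / 2 * split_sum ?h ys"
      unfolding chevalley_diff_split_sum split_sum_minus[symmetric] split_sum_scale[symmetric]
      by (rule split_sum_cong) (simp add: Phi_def)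
    show ?thesis
      unfolding snoc 3[unfolded snoc] split_sum_snoc Phi_snoc adjoint_diff_def B_gerstenhaber 1 2 by (simp add: field_simps)
  qed
qed

section \<open>Cocycles, coboundaries and constants\<close>

abbreviation \<open>\<C> \<equiv> all_cyclic_cochains s B\<close>
abbreviation \<open>\<d> \<equiv> adjoint_diff s br\<close>
abbreviation \<open>\<delta> \<equiv> chevalley_diff br\<close>
abbreviation \<open>\<J> \<equiv> chevalley_diff br ` all_forms s\<close>

definition const_form :: "complex \<Rightarrow> 'g list \<Rightarrow> complex" where
  "const_form c = (\<lambda>xs. if xs = [] then c else 0)"

lemma const_form_add: "const_form c + const_form c' = const_form (c + c')"
  by (auto simp: const_form_def fun_eq_iff)

lemma alternating_const_form: "alternating s (const_form c)"
  by (rule alternatingI) (auto simp: const_form_def)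

lemma forms_0: "forms s 0 = range const_form"
proof (intro equalityI subsetI)
  fix f assume "f \<in> forms s 0"
  then have "f = const_form (f [])" by (auto simp: forms_iff const_form_def fun_eq_iff)
  then show "f \<in> range const_form" by blast
qed (auto simp: forms_iff alternating_const_form, simp add: const_form_def)

lemma chevalley_diff_const_form: "\<delta> (const_form c) = 0"
  by (rule chevalley_diff_const) (simp add: const_form_def)

lemma all_forms_eq: "all_forms s = positive_forms s + range const_form"
proof (intro equalityI subsetI)
  fix f assume f: "f \<in> all_forms s"
  let ?g = "f + const_form (- f [])"
  have "alternating s ?g"
    using f alternating_add[OF _ alternating_const_form, of f "- f []"]
    by (simp add: all_forms_iff plus_fun_def)
  then have "?g \<in> positive_forms s"
    using f by (auto simp: all_forms_iff positive_forms_iff const_form_def)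
  moreover have "f = ?g + const_form (f [])"
    by (auto simp: const_form_def)
  ultimately show "f \<in> positive_forms s + range const_form"
    by (metis rangeI set_plus_intro)
next
  fix f assume "f \<in> positive_forms s + range const_form"
  then obtain g c where f: "f = g + const_form c" and "g \<in> positive_forms s"
    by (auto elim: set_plus_elim)
  then obtain N where g: "alternating s g" "\<forall>xs. N < length xs \<longrightarrow> g xs = 0"
    unfolding positive_forms_iff by blast
  then have "alternating s f"
    using alternating_add[OF _ alternating_const_form, of g c] by (simp add: f plus_fun_def)
  moreover have "\<forall>xs. N < length xs \<longrightarrow> f xs = 0"
    using g(2) by (auto simp: f const_form_def)
  ultimately show "f \<in> all_forms s"
    unfolding all_forms_iff by blast
qed

lemma positive_forms_add:
  "f \<in> positive_forms s \<Longrightarrow> g \<in> positive_forms s \<Longrightarrow> f + g \<in> positive_forms s"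
  unfolding positive_forms_iff
proof (elim conjE exE, intro conjI)
  fix N N' assume "\<forall>xs. N < length xs \<longrightarrow> f xs = 0" "\<forall>xs. N' < length xs \<longrightarrow> g xs = 0"
  then show "\<exists>N. \<forall>xs. N < length xs \<longrightarrow> (f + g) xs = 0"
    by (intro exI[of _ "max N N'"]) simp
qed (simp_all add: plus_fun_def alternating_add)

lemma positive_forms_scale: "f \<in> positive_forms s \<Longrightarrow> (\<lambda>xs. c * f xs) \<in> positive_forms s"
  unfolding positive_forms_iff by (auto simp: alternating_scale)

lemma zero_positive_forms: "0 \<in> positive_forms s"
  unfolding positive_forms_iff by (auto simp: zero_fun_def alternating_zero)

text \<open>Constants are closed and contribute no coboundaries. So the full complex of forms and
  the image of the cyclic complex are divided by the same space.\<close>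

lemma coboundaries_eq: "\<J> = \<delta> ` positive_forms s"
  unfolding all_forms_eq image_additive_set_plus[of \<delta>, OF chevalley_diff_add]
  by (simp add: image_image chevalley_diff_const_form)

lemma Phi_coboundaries: "Phi B ` \<d> ` \<C> = \<J>"
proof -
  have "Phi B ` \<d> ` \<C> = \<delta> ` Phi B ` \<C>"
    unfolding image_image using Phi_adjoint_diff by (intro image_cong) auto
  then show ?thesis
    by (simp only: Phi_image_cochains coboundaries_eq)
qed

lemma zero_coboundaries: "0 \<in> \<J>"
  unfolding coboundaries_eq using zero_positive_forms chevalley_diff_zero by (metis image_eqI)

text \<open>This is the absorption rule of the calculus with cosets as set sums.\<close>

lemma coboundaries_add: "\<J> + \<J> = \<J>"
proof
  show "\<J> + \<J> \<subseteq> \<J>"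
    unfolding coboundaries_eq set_plus_def
    by (auto simp: chevalley_diff_add[symmetric] intro!: imageI positive_forms_add)
  show "\<J> \<subseteq> \<J> + \<J>"
    using set_zero_plus2[OF zero_coboundaries] .
qed

lemma coboundaries_scale: "(\<lambda>f xs. c * f xs) ` \<J> + \<J> = \<J>"
proof
  have "(\<lambda>f xs. c * f xs) ` \<J> \<subseteq> \<J>"
    unfolding coboundaries_eq
    by (auto simp: chevalley_diff_scale[symmetric] intro!: imageI positive_forms_scale)
  then show "(\<lambda>f xs. c * f xs) ` \<J> + \<J> \<subseteq> \<J>"
    using coboundaries_add set_plus_mono2[of _ \<J> \<J> \<J>] by blast
  have "0 \<in> (\<lambda>f xs. c * f xs) ` \<J>"
    by (rule image_eqI[OF _ zero_coboundaries]) (simp add: fun_eq_iff)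
  then show "\<J> \<subseteq> (\<lambda>f xs. c * f xs) ` \<J> + \<J>"
    by (rule set_zero_plus2)
qed

lemma coboundaries_positive: "\<J> \<subseteq> positive_forms s"
  using chevalley_diff_positive by blast

lemma coboundaries_short: "j \<in> \<J> \<Longrightarrow> length xs \<le> 1 \<Longrightarrow> j xs = 0"
  using chevalley_diff_short by blast

lemma cyclic_coboundaries_subset: "\<d> ` \<C> \<subseteq> \<C>"
proof
  fix x assume "x \<in> \<d> ` \<C>"
  then have "Phi B x \<in> \<J>" using Phi_coboundaries by blast
  then show "x \<in> \<C>" using coboundaries_positive Phi_mem_positive_forms by blast
qed

lemma coset_subset: "x \<in> \<C> \<Longrightarrow> {x} + \<d> ` \<C> \<subseteq> \<C>"
proof
  fix y assume "x \<in> \<C>" "y \<in> {x} + \<d> ` \<C>"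
  then obtain z where "y = x + z" "z \<in> \<C>" using cyclic_coboundaries_subset by (auto simp: set_plus_def)
  then show "y \<in> \<C>"
    using \<open>x \<in> \<C>\<close> positive_forms_add[of "Phi B x" "Phi B z"]
    by (simp add: Phi_mem_positive_forms flip: Phi_add)
qed

lemma Phi_cocycles: "Phi B ` cocycles \<C> \<d> = cocycles (positive_forms s) \<delta>"
proof -
  have *: "\<d> x = 0 \<longleftrightarrow> \<delta> (Phi B x) = 0" if "x \<in> \<C>" for x
    using Phi_adjoint_diff[OF that] inj_Phi Phi_zero by (metis injD)
  then have "cocycles \<C> \<d> = {x \<in> \<C>. \<delta> (Phi B x) = 0}"
    by (auto simp: cocycles_def zero_fun_def)
  also have "Phi B ` \<dots> = cocycles (positive_forms s) \<delta>"
    unfolding Phi_image_cochains[symmetric] by (auto simp: cocycles_def zero_fun_def)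
  finally show ?thesis .
qed

lemma Phi_image_inter_cocycles: "Phi B ` (W \<inter> cocycles \<C> \<d>) = Phi B ` W \<inter> cocycles (positive_forms s) \<delta>"
  unfolding Phi_cocycles[symmetric] by (rule image_Int[OF inj_Phi])

lemma cocycles_all_forms:
  "cocycles (all_forms s) \<delta> = cocycles (positive_forms s) \<delta> + range const_form"
proof -
  have "\<delta> (f + const_form c) = \<delta> f" for f c
    by (simp add: chevalley_diff_add chevalley_diff_const_form)
  then show ?thesis
    unfolding cocycles_def all_forms_eq set_plus_def by auto
qed

lemma Phi_coset: "Phi B ` ({x} + \<d> ` \<C>) = {Phi B x} + \<J>"
  by (simp add: image_additive_set_plus[of "Phi B", OF Phi_add] Phi_coboundaries)

lemma Phi_scale_image: "Phi B ` (\<lambda>f xs. s c (f xs)) ` S = (\<lambda>f xs. c * f xs) ` Phi B ` S"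
  by (simp add: image_image Phi_scale)

text \<open>The map on cohomology is the direct image of cosets, so its injectivity is inherited
  from \<Phi>.\<close>

lemma inj_image_Phi: "inj (image (Phi B))"
  using inj_Phi by (simp add: inj_on_image inj_onI inj_image_eq_iff)

lemma gcarrier_Hc:
  shows "gcarrier (Hc_wedge s br B) = (\<lambda>x. {x} + \<d> ` \<C>) ` cocycles \<C> \<d>"
    "gcarrier (Hc_lie s br B) = (\<lambda>x. {x} + \<d> ` \<C>) ` cocycles \<C> \<d>"
  unfolding Hc_wedge_def Hc_lie_def cyclic_wedge_alg_def cyclic_lie_alg_def cohomology_alg_sel
  by (rule refl)+

section \<open>The two isomorphisms\<close>

lemma wedge_isomorphism: "graded_alg_iso (Hc_wedge s br B) (H_plus s br) (image (Phi B))"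
proof -
  let ?I = "\<d> ` \<C>" and ?P = "positive_forms s"
  let ?H = "cohomology_alg (forms_alg s) \<delta>"
  have coset: "gcoset (forms_alg s) \<J> = (\<lambda>x. {x} + \<J>)"
    unfolding forms_alg_def by (rule quot_alg_sel(1)[OF gadd_cochain_alg])
  let ?Z = "(\<lambda>x. {x} + \<J>) ` cocycles ?P \<delta>"
  have Z: "?Z = image (Phi B) ` (\<lambda>x. {x} + ?I) ` cocycles \<C> \<d>"
    unfolding Phi_cocycles[symmetric] by (simp add: image_image Phi_coset del: image_add_0)
  have sel: "gcarrier (H_plus s br) = gcarrier ?H \<inter> ?Z"
    "component (H_plus s br) n = component ?H n \<inter> ?Z"
    "gadd (H_plus s br) = gadd ?H" "gscale (H_plus s br) = gscale ?H" "gmult (H_plus s br) = gmult ?H"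
    for n
    by (simp_all add: H_plus_def sub_alg_def coset)
  have sub: "cocycles ?P \<delta> \<subseteq> cocycles (all_forms s) \<delta>"
    by (auto simp: cocycles_def positive_forms_def)
  have carrier: "gcarrier (H_plus s br) = ?Z"
    unfolding sel forms_alg_def cohomology_alg_sel using sub by blast
  show ?thesis
    unfolding graded_alg_iso_def
  proof (intro conjI allI ballI)
    show "bij_betw (image (Phi B)) (gcarrier (Hc_wedge s br B)) (gcarrier (H_plus s br))"
      unfolding carrier Z gcarrier_Hc bij_betw_def
      using inj_image_Phi by (auto intro: inj_on_subset)
  next
    fix n
    let ?W = "\<lambda>n. (if n < 0 then {0} else forms s (nat (n - 0)))"
    have "component (H_plus s br) n
        = (\<lambda>x. {x} + \<J>) ` (?W n \<inter> cocycles (all_forms s) \<delta>) \<inter> ?Z"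
      unfolding sel forms_alg_def cohomology_alg_sel ..
    also have "\<dots> = (\<lambda>x. {x} + \<J>) ` (?W n \<inter> cocycles ?P \<delta>)"
    proof (intro equalityI subsetI)
      fix X assume "X \<in> (\<lambda>x. {x} + \<J>) ` (?W n \<inter> cocycles (all_forms s) \<delta>) \<inter> ?Z"
      then obtain x y where x: "X = {x} + \<J>" "x \<in> ?W n" "x \<in> cocycles (all_forms s) \<delta>"
        and y: "X = {y} + \<J>" "y \<in> cocycles ?P \<delta>" by blast
      \<comment> \<open>The representative \<open>x\<close> differs from a form without constant
        term by a coboundary, which vanishes on the empty list; so \<open>x\<close> has no constant
        term either, and intersecting with \<open>?Z\<close> loses nothing in positive
        degree.\<close>
      have "x + 0 \<in> {y} + \<J>" using x(1) y(1) zero_coboundaries by (metis set_plus_intro singletonI)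
      then obtain j where "x = y + j" "j \<in> \<J>" by (auto simp: set_plus_def)
      then have "x [] = 0"
        using y(2) coboundaries_short[of j "[]"] by (auto simp: cocycles_def positive_forms_def)
      then have "x \<in> cocycles ?P \<delta>" using x(3) by (auto simp: cocycles_def positive_forms_def)
      then show "X \<in> (\<lambda>x. {x} + \<J>) ` (?W n \<inter> cocycles ?P \<delta>)" using x by blast
    qed (use sub in blast)
    \<comment> \<open>In positive degree this is the shift by one under \<Phi>. In degree 0 a form
      without constant term is zero, in agreement with the cyclic side, which starts in degree
      1.\<close>
    also have "?W n \<inter> cocycles ?P \<delta> = Phi B `
        ((if n < 1 then {0} else cyclic_cochains s B (nat (n - 1))) \<inter> cocycles \<C> \<d>)"
    proof (cases "n < 1")
      case False
      then have "nat (n - 0) = Suc (nat (n - 1))" by simp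
      then show ?thesis
        using False by (simp add: Phi_image_inter_cocycles Phi_image_arity)
    next
      case True
      have "?W n \<inter> cocycles ?P \<delta> \<subseteq> {0}"
      proof (cases "n < 0")
        case False
        then have "nat (n - 0) = 0" using True by simp
        then show ?thesis using False
          by (auto simp: forms_0 cocycles_def positive_forms_def const_form_def fun_eq_iff)
      qed auto
      moreover have "0 \<in> ?W n"
        by (auto simp: forms_iff zero_fun_def alternating_zero)
      ultimately have "?W n \<inter> cocycles ?P \<delta> = {0} \<inter> cocycles ?P \<delta>" by blast
      moreover have "Phi B ` ({0} \<inter> cocycles \<C> \<d>) = {0} \<inter> cocycles ?P \<delta>"
        unfolding Phi_image_inter_cocycles by (simp add: Phi_zero)
      ultimately show ?thesis
        using True by simp
    qed
    finally show "image (Phi B) ` component (Hc_wedge s br B) n = component (H_plus s br) n"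
      unfolding Hc_wedge_def cyclic_wedge_alg_def cohomology_alg_sel
      by (simp only: image_image Phi_coset)
  next
    fix S T
    show "Phi B ` gadd (Hc_wedge s br B) S T = gadd (H_plus s br) (Phi B ` S) (Phi B ` T)"
      unfolding sel Hc_wedge_def cyclic_wedge_alg_def forms_alg_def cohomology_alg_sel
      by (simp only: image_additive_set_plus[of "Phi B", OF Phi_add] Phi_coboundaries)
  next
    fix c S
    show "Phi B ` gscale (Hc_wedge s br B) c S = gscale (H_plus s br) c (Phi B ` S)"
      unfolding sel Hc_wedge_def cyclic_wedge_alg_def forms_alg_def cohomology_alg_sel
      by (simp only: image_additive_set_plus[of "Phi B", OF Phi_add] Phi_coboundaries Phi_scale_image)
  next
    fix S T assume "S \<in> gcarrier (Hc_wedge s br B)" "T \<in> gcarrier (Hc_wedge s br B)"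
    then have ST: "S \<subseteq> \<C>" "T \<subseteq> \<C>"
      unfolding gcarrier_Hc using coset_subset by (auto simp: cocycles_def)
    have "Phi B (cyclic_wedge s B x y) = wedge (Phi B x) (Phi B y)" if "x \<in> \<C>" "y \<in> \<C>" for x y
    proof -
      have "wedge (Phi B x) (Phi B y) \<in> Phi B ` \<C>"
        unfolding Phi_image_cochains using that
        by (intro wedge_positive) (simp_all add: Phi_mem_positive_forms)
      then show ?thesis
        unfolding cyclic_wedge_def by (rule f_inv_into_f)
    qed
    then have "Phi B ` (\<Union>x\<in>S. \<Union>y\<in>T. {cyclic_wedge s B x y})
        = (\<Union>x\<in>Phi B ` S. \<Union>y\<in>Phi B ` T. {wedge x y})"
      using ST by (simp add: image_UN subset_iff)
    then show "Phi B ` gmult (Hc_wedge s br B) S T = gmult (H_plus s br) (Phi B ` S) (Phi B ` T)"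
      unfolding sel Hc_wedge_def cyclic_wedge_alg_def forms_alg_def cohomology_alg_sel
      by (simp only: image_additive_set_plus[of "Phi B", OF Phi_add] Phi_coboundaries)
  qed
qed

section \<open>Classes modulo constants\<close>

lemma super_poisson_const_form:
  "super_poisson E (const_form c + \<Omega>) (const_form c' + \<Omega>') = super_poisson E \<Omega> \<Omega>'"
proof -
  \<comment> \<open>Inner derivations annihilate constants, so constants are central for the super
    Poisson bracket.\<close>
  have *: "inner_der X (\<lambda>ys. (-1) ^ (length ys + 1) * (const_form c + \<Omega>) ys)
      = inner_der X (\<lambda>ys. (-1) ^ (length ys + 1) * \<Omega> ys)"
    "inner_der X (const_form c' + \<Omega>') = inner_der X \<Omega>'" for X
    by (simp_all add: inner_der_def const_form_def fun_eq_iff)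
  show ?thesis
    by (rule ext) (simp only: super_poisson_def *)
qed

lemma super_poisson_Nil:
  "super_poisson E \<Omega> \<Omega>' [] = 2 * (\<Sum>X\<in>E. \<Omega> [X] * \<Omega>' [X])"
  by (simp add: super_poisson_def wedge_split_sum inner_der_def)

text \<open>This is the addition of the class of the constant \<open>c\<close> to \<open>R\<close>
  in cohomology; the trailing coboundaries come from the addition of the quotient.\<close>

abbreviation const_sum :: "('g list \<Rightarrow> complex) set \<Rightarrow> complex \<Rightarrow> ('g list \<Rightarrow> complex) set" where
  "const_sum R c \<equiv> R + {const_form c} + \<J>"

lemma const_sum_coset_const: "R + ({const_form c} + \<J>) + \<J> = const_sum R c"
  by (simp only: add.assoc coboundaries_add)

lemma const_sum_const_sum:
  "const_sum R c + const_sum R' c' + \<J> = const_sum (R + R' + \<J>) (c + c')"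
proof -
  have "const_sum R c + const_sum R' c' + \<J>
      = R + R' + ({const_form c} + {const_form c'}) + (\<J> + \<J> + \<J>)"
    by (simp only: ac_simps)
  also have "\<dots> = R + R' + {const_form (c + c')} + (\<J> + \<J>)"
    by (simp only: coboundaries_add set_plus_singletons const_form_add)
  finally show ?thesis by (simp only: ac_simps)
qed

lemma const_sum_add: "const_sum (const_sum R c) c' = const_sum R (c + c')"
proof -
  have "const_sum (const_sum R c) c' = R + ({const_form c} + {const_form c'}) + (\<J> + \<J>)"
    by (simp only: ac_simps)
  also have "\<dots> = const_sum R (c + c')"
    by (simp only: coboundaries_add set_plus_singletons const_form_add)
  finally show ?thesis .
qed

text \<open>For a cohomology class \<open>R\<close> this is its image in \<open>H_Q\<close>: a coset
  of cosets, hence a set of sets of forms.\<close>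

definition const_class :: "('g list \<Rightarrow> complex) set \<Rightarrow> ('g list \<Rightarrow> complex) set set" where
  "const_class R = range (const_sum R)"

text \<open>Translation by \<open>c\<close> permutes the complex numbers. Here the constant by which
  the two brackets differ is absorbed.\<close>

lemma const_class_const_sum [simp]: "const_class (const_sum R c) = const_class R"
proof -
  have "const_class (const_sum R c) = const_sum R ` range ((+) c)"
    unfolding const_class_def const_sum_add by (simp only: image_image)
  then show ?thesis
    unfolding surj_plus const_class_def .
qed

lemma scale_const_sum:
  "(\<lambda>f xs. c * f xs) ` const_sum R a + \<J> = const_sum ((\<lambda>f xs. c * f xs) ` R + \<J>) (c * a)"
proof -
  let ?m = "\<lambda>f xs. c * f xs :: complex"
  have add: "?m (f + g) = ?m f + ?m g" for f g :: "'g list \<Rightarrow> complex"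
    by (auto simp: fun_eq_iff distrib_left)
  have "?m (const_form a) = const_form (c * a)"
    by (auto simp: const_form_def fun_eq_iff)
  then have "?m ` const_sum R a + \<J> = ?m ` R + {const_form (c * a)} + (?m ` \<J> + \<J>)"
    by (simp add: image_additive_set_plus[of ?m, OF add] add.assoc)
  also have "\<dots> = ?m ` R + {const_form (c * a)} + (\<J> + \<J>)"
    by (simp only: coboundaries_scale coboundaries_add)
  finally show ?thesis by (simp only: ac_simps)
qed

lemma coset_add_const_form: "{x + const_form c} + \<J> = const_sum ({x} + \<J>) c"
proof -
  have "const_sum ({x} + \<J>) c = {x} + {const_form c} + (\<J> + \<J>)" by (simp only: ac_simps)
  then show ?thesis by (simp only: coboundaries_add set_plus_singletons)
qed

text \<open>Values of \<Phi> and coboundaries vanish on the empty list. Evaluating there shows that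
  the constant between the two cosets is 0.\<close>

lemma const_class_coset_inj:
  assumes "const_class ({Phi B x} + \<J>) = const_class ({Phi B y} + \<J>)"
  shows "{Phi B x} + \<J> = {Phi B y} + \<J>"
proof -
  have "const_sum ({Phi B x} + \<J>) 0 \<in> const_class ({Phi B y} + \<J>)"
    using assms unfolding const_class_def by blast
  then obtain c where eq: "const_sum ({Phi B x} + \<J>) 0 = const_sum ({Phi B y} + \<J>) c"
    unfolding const_class_def by blast
  have "Phi B x + const_form 0 + 0 \<in> {Phi B x + const_form 0} + \<J>"
    by (intro set_plus_intro zero_coboundaries) simp
  then have "Phi B x + const_form 0 + 0 \<in> (+) (Phi B y + const_form c) ` \<J>"
    unfolding coset_add_const_form eq singleton_image_set_plus .
  then obtain j where j: "Phi B x + const_form 0 + 0 = Phi B y + const_form c + j" "j \<in> \<J>"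
    by (rule imageE)
  have "c = 0"
    using fun_cong[OF j(1), of "[]"] coboundaries_short[OF j(2), of "[]"] by (simp add: const_form_def)
  moreover have "const_form 0 = 0" by (simp add: const_form_def fun_eq_iff)
  ultimately show ?thesis
    using eq by (simp add: add.assoc coboundaries_add)
qed

text \<open>The shifts \<open>a\<close> and \<open>b\<close> disappear because constants are
  central. The constant term of the bracket involves only values on lists of length 1, which are the
  same for all representatives.\<close>

lemma super_poisson_coset:
  assumes E: "orthonormal_basis s B E" and x: "x \<in> \<C>" and y: "y \<in> \<C>"
  shows "(\<Union>f\<in>const_sum ({Phi B x} + \<J>) a. \<Union>g\<in>const_sum ({Phi B y} + \<J>) b. {super_poisson E f g}) + \<J>
    = const_sum (Phi B ` ((\<Union>f\<in>{x} + \<d> ` \<C>. \<Union>g\<in>{y} + \<d> ` \<C>. {gerstenhaber s f g}) + \<d> ` \<C>))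
       (super_poisson E (Phi B x) (Phi B y) [])"
proof -
  let ?S = "{x} + \<d> ` \<C>" and ?T = "{y} + \<d> ` \<C>" and ?c = "super_poisson E (Phi B x) (Phi B y) []"
  \<comment> \<open>A coset shifted by a constant becomes a translate of a \<Phi>-image, so the
    unions can be indexed by cyclic cochains.\<close>
  have sum: "const_sum ({Phi B z} + \<J>) a = (+) (const_form a) ` Phi B ` ({z} + \<d> ` \<C>)" for z a
  proof -
    have "const_sum ({Phi B z} + \<J>) a = ({Phi B z} + (\<J> + \<J>)) + {const_form a}"
      by (simp only: ac_simps)
    also have "\<dots> = (+) (const_form a) ` Phi B ` ({z} + \<d> ` \<C>)"
      unfolding coboundaries_add Phi_coset singleton_image_set_plus by (rule add.commute)
    finally show ?thesis .
  qed
  have short: "Phi B f [X] = Phi B z [X]" if f: "f \<in> {z} + \<d> ` \<C>" for f z X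
  proof -
    have "Phi B f \<in> (+) (Phi B z) ` \<J>"
      unfolding singleton_image_set_plus Phi_coset[symmetric] using f by (rule imageI)
    then obtain j where "Phi B f = Phi B z + j" "j \<in> \<J>"
      by (rule imageE)
    then show ?thesis using coboundaries_short[of j "[X]"] by simp
  qed
  have "super_poisson E (Phi B f) (Phi B g) = Phi B (gerstenhaber s f g) + const_form ?c"
    if "f \<in> ?S" "g \<in> ?T" for f g
  proof
    fix xs
    have "f \<in> \<C>" "g \<in> \<C>" using that coset_subset x y by blast+
    then show "super_poisson E (Phi B f) (Phi B g) xs = (Phi B (gerstenhaber s f g) + const_form ?c) xs"
      using Phi_gerstenhaber[OF E, of f g xs] short[OF that(1)] short[OF that(2)]
      by (cases "xs = []") (simp_all add: super_poisson_Nil const_form_def)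
  qed
  then have "(\<Union>f\<in>?S. \<Union>g\<in>?T. {super_poisson E (Phi B f) (Phi B g)})
      = (\<Union>f\<in>?S. \<Union>g\<in>?T. {Phi B (gerstenhaber s f g) + const_form ?c})"
    by (intro SUP_cong refl) simp
  also have "\<dots> = Phi B ` (\<Union>f\<in>?S. \<Union>g\<in>?T. {gerstenhaber s f g}) + {const_form ?c}"
    by (simp only: set_plus_singletons[symmetric] UN_set_plus image_UN image_insert image_empty)
  finally have *: "(\<Union>f\<in>?S. \<Union>g\<in>?T. {super_poisson E (Phi B f) (Phi B g)}) + \<J>
      = Phi B ` (\<Union>f\<in>?S. \<Union>g\<in>?T. {gerstenhaber s f g}) + {const_form ?c} + (\<J> + \<J>)"
    by (simp only: coboundaries_add)
  have "(\<Union>f\<in>const_sum ({Phi B x} + \<J>) a. \<Union>g\<in>const_sum ({Phi B y} + \<J>) b. {super_poisson E f g})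
      = (\<Union>f\<in>?S. \<Union>g\<in>?T. {super_poisson E (Phi B f) (Phi B g)})"
    unfolding sum by (simp add: super_poisson_const_form)
  then show ?thesis
    unfolding image_additive_set_plus[of "Phi B", OF Phi_add] Phi_coboundaries
    using * by (simp only: ac_simps)
qed

lemma lie_isomorphism:
  assumes E: "orthonormal_basis s B E"
  shows "graded_alg_iso (Hc_lie s br B) (H_Q s br E) (\<lambda>S. const_class (Phi B ` S))"
proof -
  let ?I = "\<d> ` \<C>" and ?P = "positive_forms s" and ?f = "\<lambda>S. const_class (Phi B ` S)"
  let ?H = "cohomology_alg (poisson_alg s E) \<delta>"
  let ?K = "gcoset (poisson_alg s E) \<J> ` forms s 0"
  note H_sel = cohomology_alg_sel[of "(*)" "all_forms s" "forms s" "- 2" "super_poisson E" \<delta>,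
      folded poisson_alg_def]
  have K: "?K = range (\<lambda>c. {const_form c} + \<J>)"
    unfolding poisson_alg_def quot_alg_sel(1)[OF gadd_cochain_alg] forms_0 by (simp add: image_image)
  have coset: "gcoset ?H ?K = const_class"
    unfolding gcoset_def K const_class_def H_sel image_image const_sum_coset_const ..
  have sel: "gcarrier (H_Q s br E) = const_class ` gcarrier ?H"
    "component (H_Q s br E) n = const_class ` component ?H n"
    "gadd (H_Q s br E) X Y = (\<Union>R\<in>X. \<Union>R'\<in>Y. const_class (R + R' + \<J>))"
    "gscale (H_Q s br E) c X = (\<Union>R\<in>X. const_class (gscale ?H c R))"
    "gmult (H_Q s br E) X Y = (\<Union>R\<in>X. \<Union>R'\<in>Y. const_class (gmult ?H R R'))" for n X Y c
    by (simp_all add: H_Q_def quot_alg_def coset H_sel)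
  have class_add: "const_class ({x + const_form c} + \<J>) = const_class ({x} + \<J>)" for x c
    unfolding coset_add_const_form by simp
  have f_image: "?f ` (\<lambda>x. {x} + ?I) ` W = (\<lambda>x. const_class ({x} + \<J>)) ` Phi B ` W" for W
    by (simp only: image_image Phi_coset)
  \<comment> \<open>Adding a constant does not change a class of \<open>H_Q\<close>, so each class
    has a representative without constant term, which \<Phi> reaches.\<close>
  have carrier: "?f ` gcarrier (Hc_lie s br B) = gcarrier (H_Q s br E)"
  proof -
    have "gcarrier (H_Q s br E)
        = (\<lambda>x. const_class ({x} + \<J>)) ` (cocycles ?P \<delta> + range const_form)"
      unfolding sel H_sel cocycles_all_forms by (simp only: image_image)
    also have "\<dots> = (\<lambda>x. const_class ({x} + \<J>)) ` cocycles ?P \<delta>"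
    proof (intro equalityI subsetI)
      fix X assume "X \<in> (\<lambda>x. const_class ({x} + \<J>)) ` (cocycles ?P \<delta> + range const_form)"
      then obtain x c where "x \<in> cocycles ?P \<delta>" "X = const_class ({x + const_form c} + \<J>)"
        unfolding set_plus_def by blast
      then show "X \<in> (\<lambda>x. const_class ({x} + \<J>)) ` cocycles ?P \<delta>"
        unfolding class_add by blast
    next
      fix X assume "X \<in> (\<lambda>x. const_class ({x} + \<J>)) ` cocycles ?P \<delta>"
      then obtain x where "x \<in> cocycles ?P \<delta>" "X = const_class ({x + const_form 0} + \<J>)"
        unfolding class_add by blast
      then show "X \<in> (\<lambda>x. const_class ({x} + \<J>)) ` (cocycles ?P \<delta> + range const_form)"
        by (intro image_eqI[OF _ set_plus_intro]) auto
    qed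
    finally show ?thesis
      unfolding gcarrier_Hc f_image Phi_cocycles by simp
  qed
  show ?thesis
    unfolding graded_alg_iso_def
  proof (intro conjI allI ballI)
    have "inj_on ?f (gcarrier (Hc_lie s br B))"
    proof (rule inj_onI)
      fix S T assume "S \<in> gcarrier (Hc_lie s br B)" "T \<in> gcarrier (Hc_lie s br B)"
        and eq: "?f S = ?f T"
      then obtain x y where "S = {x} + ?I" "T = {y} + ?I"
        unfolding gcarrier_Hc by blast
      then have "Phi B ` S = Phi B ` T"
        using const_class_coset_inj[of x y] eq by (simp only: Phi_coset)
      then show "S = T" using inj_image_Phi by (simp add: inj_eq)
    qed
    then show "bij_betw ?f (gcarrier (Hc_lie s br B)) (gcarrier (H_Q s br E))"
      using carrier by (simp add: bij_betw_def)
  next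
    fix n :: int
    let ?W = "if n < - 2 then {0} else forms s (nat (n - - 2))"
    let ?W' = "if n < - 1 then {0} else cyclic_cochains s B (nat (n - - 1))"
    have "component (H_Q s br E) n = (\<lambda>x. const_class ({x} + \<J>)) ` (?W \<inter> cocycles (all_forms s) \<delta>)"
      unfolding sel H_sel by (simp only: image_image)
    also have "\<dots> = (\<lambda>x. const_class ({x} + \<J>)) ` Phi B ` (?W' \<inter> cocycles \<C> \<d>)"
    proof -
      have zero: "0 \<in> cocycles (all_forms s) \<delta>" "0 \<in> cocycles ?P \<delta>"
        using zero_positive_forms chevalley_diff_zero
        by (auto simp: cocycles_def positive_forms_def zero_fun_def)
      \<comment> \<open>Degree -2 holds only the constants, which become zero in \<open>H_Q\<close>,
        while the cyclic side starts in degree -1. From there on the shifts 2 and 1 differ by the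
        one argument that \<Phi> adds.\<close>
      consider "n < - 2" | "n = - 2" | "n \<ge> - 1" by linarith
      then show ?thesis
      proof cases
        case 1
        then show ?thesis
          using zero unfolding Phi_image_inter_cocycles by (simp add: Phi_zero)
      next
        case 2
        have "forms s 0 \<inter> cocycles (all_forms s) \<delta> = range const_form"
          unfolding forms_0 cocycles_all_forms
          using zero(2) set_plus_intro[of 0 "cocycles ?P \<delta>" _ "range const_form"]
          by auto
        moreover have "const_class ({const_form c} + \<J>) = const_class \<J>" for c
          using class_add[of 0 c] by simp
        ultimately show ?thesis
          using 2 zero unfolding Phi_image_inter_cocycles by (simp add: Phi_zero image_image)
      next
        case 3
        then have n: "nat (n - - 2) = Suc (nat (n - - 1))" by simp
        have "forms s (Suc k) \<inter> cocycles (all_forms s) \<delta> = forms s (Suc k) \<inter> cocycles ?P \<delta>" for k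
          by (auto simp: cocycles_def positive_forms_def forms_iff)
        then show ?thesis
          using 3 unfolding Phi_image_inter_cocycles n by (simp add: Phi_image_arity)
      qed
    qed
    finally show "?f ` component (Hc_lie s br B) n = component (H_Q s br E) n"
      unfolding Hc_lie_def cyclic_lie_alg_def cohomology_alg_sel f_image by simp
  next
    fix S T
    \<comment> \<open>All choices of representatives differ by constants and give the same class, so
      the union defining the sum is a union of equal sets. The same holds for multiples
      below.\<close>
    have "gadd (H_Q s br E) (?f S) (?f T) = const_class (Phi B ` S + Phi B ` T + \<J>)"
      unfolding sel const_class_def[of "Phi B ` _"] by (simp add: const_sum_const_sum)
    then show "?f (gadd (Hc_lie s br B) S T) = gadd (H_Q s br E) (?f S) (?f T)"
      unfolding Hc_lie_def cyclic_lie_alg_def cohomology_alg_sel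
      by (simp only: image_additive_set_plus[of "Phi B", OF Phi_add] Phi_coboundaries)
  next
    fix c S
    have "gscale (H_Q s br E) c (?f S) = const_class ((\<lambda>f xs. c * f xs) ` Phi B ` S + \<J>)"
      unfolding sel H_sel const_class_def[of "Phi B ` _"] by (simp add: scale_const_sum)
    then show "?f (gscale (Hc_lie s br B) c S) = gscale (H_Q s br E) c (?f S)"
      unfolding Hc_lie_def cyclic_lie_alg_def cohomology_alg_sel
      by (simp only: image_additive_set_plus[of "Phi B", OF Phi_add] Phi_coboundaries Phi_scale_image)
  next
    fix S T assume "S \<in> gcarrier (Hc_lie s br B)" "T \<in> gcarrier (Hc_lie s br B)"
    then obtain x y where xy: "x \<in> \<C>" "y \<in> \<C>" "S = {x} + ?I" "T = {y} + ?I"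
      unfolding gcarrier_Hc by (auto simp: cocycles_def)
    \<comment> \<open>Every pair of representatives gives one and the same translate of the
      Gerstenhaber class by a constant, which \<open>const_class\<close> ignores.\<close>
    have "gmult (H_Q s br E) (?f S) (?f T) = const_class (Phi B `
        ((\<Union>f\<in>S. \<Union>g\<in>T. {gerstenhaber s f g}) + ?I))"
      unfolding sel H_sel xy(3,4) Phi_coset const_class_def[of "{Phi B _} + \<J>"]
      by (simp only: UN_simps(10) image_image super_poisson_coset[OF E xy(1,2)] const_class_const_sum) simp
    then show "?f (gmult (Hc_lie s br B) S T) = gmult (H_Q s br E) (?f S) (?f T)"
      unfolding Hc_lie_def cyclic_lie_alg_def cohomology_alg_sel by simp
  qed
qed

end

theorem proposition7p4p7:
  fixes s :: "complex \<Rightarrow> 'g::ab_group_add \<Rightarrow> 'g"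
    and br :: "'g \<Rightarrow> 'g \<Rightarrow> 'g"
    and B :: "'g \<Rightarrow> 'g \<Rightarrow> complex"
  assumes "quadratic_lie_algebra s br B"
  shows "graded_alg_isomorphic (Hc_wedge s br B) (H_plus s br) \<and>
         (\<forall>E. orthonormal_basis s B E \<longrightarrow>
            graded_alg_isomorphic (Hc_lie s br B) (H_Q s br E))"
  using quadratic_lie_algebra.wedge_isomorphism[OF assms]
    quadratic_lie_algebra.lie_isomorphism[OF assms]
  unfolding graded_alg_isomorphic_def by blast

end
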